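(* Let $(V_1,\mu_1),\dots,(V_k,\mu_k)$ be probability spaces and $\mu=\mu_1\otimes\cdots\otimes\mu_k$. Let $f\in L^2(V_{[k]},\mu)$ be of degree $d$. Then \[ \|f\|_{4}^{4}\le 2\cdot 9^{d}\sum_{T\subseteq[k],\,|T|\le d}(9d)^{|T|}\,\mathbb{E}_{x\sim\mu_T}\big[I_{T,x}[f]^{2}\big]. \]
   Context: For $S\subseteq[k]$, $V_S=\prod_{i\in S}V_i$, $\mu_S=\bigotimes_{i\in S}\mu_i$, $\bar S=[k]\setminus S$. For $T\subseteq[k]$, $A_Tf(x)=\mathbb E_{y\sim\mu_{\bar T}}[f(x_T,y)]$. The Efron--Stein components are $f^{=S}=\sum_{T\subseteq S}(-1)^{|S\setminus T|}A_Tf$, so $f=\sum_S f^{=S}$. $f$ is of degree $d$ if $f^{=S}=0$ whenever $|S|>d$. The Laplacian is $L_T[f]=\sum_{S\supseteq T}f^{=S}$; for $x\in V_T$ the derivative $D_{T,x}f\in L^2(V_{\bar T},\mu_{\bar T})$ is $D_{T,x}f=L_T[f](x,\cdot)$, and the influence is $I_{T,x}[f]=\|D_{T,x}f\|_{L^2(\mu_{\bar T})}^2$; for $T=\varnothing$, $I_{\varnothing}[f]=\|f\|_2^2$. *)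

theory Defs
  imports "HOL-Probability.Probability"
begin

text \<open>
  The space $(V_S, \mu_S)$ is the product measure \<open>PiM S M\<close>. A point $(x_T, y)$ of the full product is
  \<open>merge T (I - T) (x, y)\<close>; \<open>merge\<close> reads only the coordinates in \<open>T\<close> of its first component, so
  the same expression serves for \<open>x\<close> in $V_I$ (averaging) and for \<open>x\<close> in $V_T$ (derivatives).
  Elements of $L^2$ are represented by square-integrable functions, and an
  equation between elements of $L^2$ is an almost-everywhere equation.
\<close>

definition in_L2 :: "'b measure \<Rightarrow> ('b \<Rightarrow> real) \<Rightarrow> bool" where
  "in_L2 N f \<longleftrightarrow> f \<in> borel_measurable N \<and> integrable N (\<lambda>x. (f x)\<^sup>2)"

definition avg_op ::
  "'i set \<Rightarrow> ('i \<Rightarrow> 'a measure) \<Rightarrow> 'i set \<Rightarrow> (('i \<Rightarrow> 'a) \<Rightarrow> real) \<Rightarrow> ('i \<Rightarrow> 'a) \<Rightarrow> real" where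
  "avg_op I M T f x = (\<integral>y. f (merge T (I - T) (x, y)) \<partial>PiM (I - T) M)"

definition efron_stein ::
  "'i set \<Rightarrow> ('i \<Rightarrow> 'a measure) \<Rightarrow> 'i set \<Rightarrow> (('i \<Rightarrow> 'a) \<Rightarrow> real) \<Rightarrow> ('i \<Rightarrow> 'a) \<Rightarrow> real" where
  "efron_stein I M S f x = (\<Sum>T\<in>Pow S. (-1) ^ card (S - T) * avg_op I M T f x)"

definition of_degree ::
  "'i set \<Rightarrow> ('i \<Rightarrow> 'a measure) \<Rightarrow> nat \<Rightarrow> (('i \<Rightarrow> 'a) \<Rightarrow> real) \<Rightarrow> bool" where
  "of_degree I M d f \<longleftrightarrow>
     (\<forall>S\<subseteq>I. card S > d \<longrightarrow> (AE x in PiM I M. efron_stein I M S f x = 0))"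

definition laplacian ::
  "'i set \<Rightarrow> ('i \<Rightarrow> 'a measure) \<Rightarrow> 'i set \<Rightarrow> (('i \<Rightarrow> 'a) \<Rightarrow> real) \<Rightarrow> ('i \<Rightarrow> 'a) \<Rightarrow> real" where
  "laplacian I M T f x = (\<Sum>S | T \<subseteq> S \<and> S \<subseteq> I. efron_stein I M S f x)"

definition derivative ::
  "'i set \<Rightarrow> ('i \<Rightarrow> 'a measure) \<Rightarrow> 'i set \<Rightarrow> ('i \<Rightarrow> 'a) \<Rightarrow> (('i \<Rightarrow> 'a) \<Rightarrow> real) \<Rightarrow> ('i \<Rightarrow> 'a) \<Rightarrow> real" where
  "derivative I M T x f y = laplacian I M T f (merge T (I - T) (x, y))"

text \<open>
  The influence takes values in $[0,\infty]$: it is finite for almost every \<open>x\<close>, but its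
  second moment may be infinite, as may the fourth moment of \<open>f\<close>.
\<close>

definition influence ::
  "'i set \<Rightarrow> ('i \<Rightarrow> 'a measure) \<Rightarrow> 'i set \<Rightarrow> ('i \<Rightarrow> 'a) \<Rightarrow> (('i \<Rightarrow> 'a) \<Rightarrow> real) \<Rightarrow> ennreal" where
  "influence I M T x f = (\<integral>\<^sup>+y. ennreal ((derivative I M T x f y)\<^sup>2) \<partial>PiM (I - T) M)"

end

theory Submission
  imports Defs
begin

text \<open>
  The theorem follows from a noise inequality for pairs of functions. If the Efron--Stein components
  of \<open>F\<close> and \<open>G\<close> are damped by $\rho^{|S|}$, then
  $E[(T_\rho F)^2 (T_\rho G)^2] \le \sum_T \beta^{|T|} E_x[\|D_{T,x}F\|^2 \|D_{T,x}G\|^2]$ whenever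
  $3\rho^2 + \delta \le 1$ and $\beta \ge \rho^4 + 2\rho^6/\delta$. It is proved one coordinate at a time: write
  $T_\rho F = a + \rho h$ and $T_\rho G = b + \rho k$ with \<open>a\<close>, \<open>b\<close> independent of the coordinate and
  \<open>h\<close>, \<open>k\<close> of mean zero in it. In the expansion of the product of squares the terms linear in \<open>h\<close> or \<open>k\<close>
  integrate to zero, and the others are at most $a^2k^2 + h^2b^2 + \beta h^2k^2$, to whose terms the inequality in
  the remaining coordinates applies. The statement for pairs is what makes the mixed terms inductive.
  A function of degree \<open>d\<close> is $T_\rho$ of its rescaling by $\rho^{-|S|}$, which costs $\rho^{-4d}$;
  with $\rho^2 = (1 - \delta)/3$ and $\delta = 1/(4d+1)$ this is at most $2 \cdot 9^d$, and $\beta = 9d$ is admissible.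
\<close>

section \<open>The one-coordinate inequality\<close>

text \<open>The cross term with coefficient \<open>4 * \<rho>\<^sup>2\<close> is split evenly
  between \<open>(a * k)\<^sup>2\<close> and \<open>(b * h)\<^sup>2\<close>, which raises their
  coefficient to \<open>3 * \<rho>\<^sup>2\<close>. Each cubic term is split with weight \<delta>:
  it adds \<delta> to one of these coefficients and \<open>\<rho> ^ 6 / \<delta>\<close> to that of
  \<open>(h * k)\<^sup>2\<close>. The hypotheses bound the resulting coefficients by 1 and \<beta>.
  The terms linear in \<open>h\<close> or \<open>k\<close> stay exact because they integrate to
  zero.\<close>

lemma quartic_expansion_le:
  fixes a b h k \<rho> \<delta> \<beta> :: real
  assumes "0 \<le> \<rho>" "0 < \<delta>" "3 * \<rho>\<^sup>2 + \<delta> \<le> 1" "\<rho> ^ 4 + 2 * \<rho> ^ 6 / \<delta> \<le> \<beta>"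
  shows "(a + \<rho> * h)\<^sup>2 * (b + \<rho> * k)\<^sup>2
    \<le> a\<^sup>2 * b\<^sup>2 + (2 * \<rho> * a\<^sup>2 * b * k + 2 * \<rho> * a * b\<^sup>2 * h)
      + (a\<^sup>2 * k\<^sup>2 + h\<^sup>2 * b\<^sup>2 + \<beta> * (h\<^sup>2 * k\<^sup>2))"
proof -
  define c where "c = \<rho> ^ 6 / \<delta>"
  have young: "2 * \<rho> ^ 3 * u * v \<le> \<delta> * u\<^sup>2 + c * v\<^sup>2" for u v :: real
  proof -
    have "0 \<le> (\<delta> * u - \<rho> ^ 3 * v)\<^sup>2 / \<delta>" using assms by simp
    also have "\<dots> = \<delta> * u\<^sup>2 + c * v\<^sup>2 - 2 * \<rho> ^ 3 * u * v"
      using \<open>0 < \<delta>\<close> by (simp add: c_def field_simps power2_eq_square eval_nat_numeral)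
    finally show ?thesis by simp
  qed
  have 1: "2 * \<rho> ^ 3 * (a * k) * (h * k) \<le> \<delta> * (a * k)\<^sup>2 + c * (h * k)\<^sup>2"
    and 2: "2 * \<rho> ^ 3 * (b * h) * (h * k) \<le> \<delta> * (b * h)\<^sup>2 + c * (h * k)\<^sup>2"
    by (rule young)+
  have 3: "\<rho>\<^sup>2 * (4 * (a * k) * (b * h)) \<le> \<rho>\<^sup>2 * (2 * ((a * k)\<^sup>2 + (b * h)\<^sup>2))"
    using sum_squares_bound[of "a * k" "b * h"] by (intro mult_left_mono) auto
  have 4: "(3 * \<rho>\<^sup>2 + \<delta>) * ((a * k)\<^sup>2 + (b * h)\<^sup>2) \<le> 1 * ((a * k)\<^sup>2 + (b * h)\<^sup>2)"
    using assms by (intro mult_right_mono) auto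
  have 5: "(\<rho> ^ 4 + 2 * c) * (h * k)\<^sup>2 \<le> \<beta> * (h * k)\<^sup>2"
    using assms by (intro mult_right_mono) (auto simp: c_def)
  have "(a + \<rho> * h)\<^sup>2 * (b + \<rho> * k)\<^sup>2
    = a\<^sup>2 * b\<^sup>2 + (2 * \<rho> * a\<^sup>2 * b * k + 2 * \<rho> * a * b\<^sup>2 * h)
      + \<rho>\<^sup>2 * ((a * k)\<^sup>2 + (b * h)\<^sup>2) + \<rho>\<^sup>2 * (4 * (a * k) * (b * h))
      + 2 * \<rho> ^ 3 * (a * k) * (h * k) + 2 * \<rho> ^ 3 * (b * h) * (h * k) + \<rho> ^ 4 * (h * k)\<^sup>2"
    by (simp add: power2_eq_square eval_nat_numeral algebra_simps)
  also have "\<dots> \<le> a\<^sup>2 * b\<^sup>2 + (2 * \<rho> * a\<^sup>2 * b * k + 2 * \<rho> * a * b\<^sup>2 * h)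
      + ((3 * \<rho>\<^sup>2 + \<delta>) * ((a * k)\<^sup>2 + (b * h)\<^sup>2) + (\<rho> ^ 4 + 2 * c) * (h * k)\<^sup>2)"
    using 1 2 3 by (simp add: algebra_simps)
  also have "\<dots> \<le> a\<^sup>2 * b\<^sup>2 + (2 * \<rho> * a\<^sup>2 * b * k + 2 * \<rho> * a * b\<^sup>2 * h)
      + (1 * ((a * k)\<^sup>2 + (b * h)\<^sup>2) + \<beta> * (h * k)\<^sup>2)"
    using 4 5 by (intro add_mono order_refl)
  finally show ?thesis by (simp add: power_mult_distrib mult.commute add_ac)
qed

text \<open>Only integrability of \<open>h\<close> and \<open>k\<close> is assumed, so the moments
  on the right may be infinite. Then nothing is to be shown; otherwise the quadratic part
  \<open>q\<close> is integrable, and the signed linear part \<open>l\<close> can be integrated away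
  by the Bochner integral.\<close>

lemma (in prob_space) nn_integral_quartic_le:
  fixes h k :: "'a \<Rightarrow> real" and a b \<rho> \<delta> \<beta> :: real
  assumes par: "0 \<le> \<rho>" "0 < \<delta>" "3 * \<rho>\<^sup>2 + \<delta> \<le> 1" "\<rho> ^ 4 + 2 * \<rho> ^ 6 / \<delta> \<le> \<beta>"
    and h[simp]: "integrable M h" "integral\<^sup>L M h = 0" and k[simp]: "integrable M k" "integral\<^sup>L M k = 0"
  shows "(\<integral>\<^sup>+t. ennreal ((a + \<rho> * h t)\<^sup>2 * (b + \<rho> * k t)\<^sup>2) \<partial>M)
    \<le> ennreal (a\<^sup>2 * b\<^sup>2) + (\<integral>\<^sup>+t. ennreal (a\<^sup>2 * (k t)\<^sup>2) \<partial>M) + (\<integral>\<^sup>+t. ennreal ((h t)\<^sup>2 * b\<^sup>2) \<partial>M)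
      + ennreal \<beta> * (\<integral>\<^sup>+t. ennreal ((h t)\<^sup>2 * (k t)\<^sup>2) \<partial>M)"
proof -
  have [measurable]: "h \<in> borel_measurable M" "k \<in> borel_measurable M"
    using h(1) k(1) by (auto intro: borel_measurable_integrable)
  have "0 \<le> \<rho> ^ 4 + 2 * \<rho> ^ 6 / \<delta>" using par by simp
  then have \<beta>: "0 \<le> \<beta>" using par by linarith
  define l where "l t = 2 * \<rho> * a\<^sup>2 * b * k t + 2 * \<rho> * a * b\<^sup>2 * h t" for t
  define q where "q t = a\<^sup>2 * (k t)\<^sup>2 + (h t)\<^sup>2 * b\<^sup>2 + \<beta> * ((h t)\<^sup>2 * (k t)\<^sup>2)" for t
  have [measurable]: "q \<in> borel_measurable M" unfolding q_def by measurable
  have q0: "0 \<le> q t" for t using \<beta> by (simp add: q_def)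
  have le: "(a + \<rho> * h t)\<^sup>2 * (b + \<rho> * k t)\<^sup>2 \<le> a\<^sup>2 * b\<^sup>2 + l t + q t" for t
    unfolding l_def q_def by (rule quartic_expansion_le[OF par])
  have "(\<integral>\<^sup>+t. ennreal ((a + \<rho> * h t)\<^sup>2 * (b + \<rho> * k t)\<^sup>2) \<partial>M)
      \<le> ennreal (a\<^sup>2 * b\<^sup>2) + (\<integral>\<^sup>+t. ennreal (q t) \<partial>M)"
  proof (cases "(\<integral>\<^sup>+t. ennreal (q t) \<partial>M) = \<infinity>")
    case False
    then have q: "integrable M q"
      using q0 by (intro integrableI_nonneg) (auto simp: less_top)
    have l: "integrable M l" "integral\<^sup>L M l = 0" by (simp_all add: l_def[abs_def])
    have "(\<integral>\<^sup>+t. ennreal ((a + \<rho> * h t)\<^sup>2 * (b + \<rho> * k t)\<^sup>2) \<partial>M)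
        \<le> (\<integral>\<^sup>+t. ennreal (a\<^sup>2 * b\<^sup>2 + l t + q t) \<partial>M)"
      using le by (intro nn_integral_mono ennreal_leI)
    \<comment> \<open>The integrand contains the signed \<open>l\<close> but is nonnegative, since
      by \<open>le\<close> it dominates a product of squares.\<close>
    also have "\<dots> = ennreal (\<integral>t. a\<^sup>2 * b\<^sup>2 + l t + q t \<partial>M)"
      using l q by (intro nn_integral_eq_integral AE_I2 order_trans[OF _ le]) auto
    also have "\<dots> = ennreal (a\<^sup>2 * b\<^sup>2 + (\<integral>t. q t \<partial>M))"
      using l q by (simp add: prob_space)
    also have "\<dots> = ennreal (a\<^sup>2 * b\<^sup>2) + (\<integral>\<^sup>+t. ennreal (q t) \<partial>M)"
      using q q0 by (simp add: nn_integral_eq_integral)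
    finally show ?thesis .
  qed simp
  also have "(\<integral>\<^sup>+t. ennreal (q t) \<partial>M)
      = (\<integral>\<^sup>+t. ennreal (a\<^sup>2 * (k t)\<^sup>2) + ennreal ((h t)\<^sup>2 * b\<^sup>2) + ennreal \<beta> * ennreal ((h t)\<^sup>2 * (k t)\<^sup>2) \<partial>M)"
    using \<beta> by (simp add: q_def ennreal_mult ennreal_plus)
  also have "\<dots> = (\<integral>\<^sup>+t. ennreal (a\<^sup>2 * (k t)\<^sup>2) \<partial>M) + (\<integral>\<^sup>+t. ennreal ((h t)\<^sup>2 * b\<^sup>2) \<partial>M)
      + ennreal \<beta> * (\<integral>\<^sup>+t. ennreal ((h t)\<^sup>2 * (k t)\<^sup>2) \<partial>M)"
    by (simp add: nn_integral_add nn_integral_cmult)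
  finally show ?thesis by (simp add: add_ac)
qed

section \<open>Product spaces\<close>

locale prob_family =
  fixes M :: "'i \<Rightarrow> 'a measure"
  assumes prob_space_M: "\<And>i. prob_space (M i)"

text \<open>The parent locale fixes one index set. The lemmas below name their own, which varies in
  the induction, so \<open>{}\<close> is taken.\<close>

sublocale prob_family \<subseteq> product_prob_space M "{}"
  by (intro product_prob_space.intro product_prob_space_axioms.intro product_sigma_finite.intro
      prob_space_M prob_space_imp_sigma_finite)

context prob_family
begin

lemma prob_space_Pi: "prob_space (PiM I M)"
  by (intro prob_space_PiM prob_space_M)

lemma pair_sigma_finite_Pi:
  "pair_sigma_finite (PiM I M) (PiM J M)" "pair_sigma_finite (M i) (PiM I M)"
  "pair_sigma_finite (PiM I M) (M i)"
  by (auto intro!: pair_sigma_finite.intro prob_space_imp_sigma_finite prob_space_Pi prob_space_M)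

section \<open>Adjoining or resampling one coordinate\<close>

lemma measurable_insert_coordinate:
  "(\<lambda>(t, x). x(i := t)) \<in> M i \<Otimes>\<^sub>M PiM I M \<rightarrow>\<^sub>M PiM (insert i I) M"
  by measurable

text \<open>For independent \<open>t\<close> and \<open>x\<close>, the point
  \<open>x(i := t)\<close> has the product law. This also covers \<open>i\<close> in
  \<open>I\<close>, where the coordinate is resampled; the later uses with
  \<open>insert i I = I\<close> rely on it.\<close>

lemma AE_insert_coordinate:
  assumes "AE x in PiM (insert i I) M. P x"
  shows "AE t in M i. AE x in PiM I M. P (x(i := t))"
    and "AE x in PiM I M. AE t in M i. P (x(i := t))"
proof -
  have "AE w in M i \<Otimes>\<^sub>M PiM I M. P (case w of (t, x) \<Rightarrow> x(i := t))"
    by (rule AE_distrD[OF measurable_insert_coordinate], subst distr_pair_PiM_eq_PiM)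
      (use assms in \<open>simp_all add: prob_space_M\<close>)
  note * = this
  interpret A: pair_sigma_finite "M i" "PiM I M" by (rule pair_sigma_finite_Pi)
  interpret B: pair_sigma_finite "PiM I M" "M i" by (rule pair_sigma_finite_Pi)
  show "AE t in M i. AE x in PiM I M. P (x(i := t))"
    using A.AE_pair[OF *] by simp
  have "AE w in PiM I M \<Otimes>\<^sub>M M i. P (case (case w of (x, y) \<Rightarrow> (y, x)) of (t, x) \<Rightarrow> x(i := t))"
    by (rule AE_distrD[OF measurable_pair_swap'], subst A.distr_pair_swap[symmetric], rule *)
  from B.AE_pair[OF this] show "AE x in PiM I M. AE t in M i. P (x(i := t))" by simp
qed

lemma integral_insert_coordinate:
  fixes g :: "('i \<Rightarrow> 'a) \<Rightarrow> real"
  assumes "integrable (PiM (insert i I) M) g"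
  shows "AE x in PiM I M. integrable (M i) (\<lambda>t. g (x(i := t)))"
    and "AE t in M i. integrable (PiM I M) (\<lambda>x. g (x(i := t)))"
    and "integrable (M i) (\<lambda>t. \<integral>x. g (x(i := t)) \<partial>PiM I M)"
    and "(\<integral>t. \<integral>x. g (x(i := t)) \<partial>PiM I M \<partial>M i) = integral\<^sup>L (PiM (insert i I) M) g"
    and "(\<integral>x. \<integral>t. g (x(i := t)) \<partial>M i \<partial>PiM I M) = integral\<^sup>L (PiM (insert i I) M) g"
proof -
  interpret A: pair_sigma_finite "M i" "PiM I M" by (rule pair_sigma_finite_Pi)
  have D: "distr (M i \<Otimes>\<^sub>M PiM I M) (PiM (insert i I) M) (\<lambda>(t, x). x(i := t)) = PiM (insert i I) M"
    by (simp add: distr_pair_PiM_eq_PiM prob_space_M)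
  have "integrable (M i \<Otimes>\<^sub>M PiM I M) (\<lambda>w. g (case w of (t, x) \<Rightarrow> x(i := t)))"
    by (rule integrable_distr[OF measurable_insert_coordinate]) (use assms D in simp)
  then have int: "integrable (M i \<Otimes>\<^sub>M PiM I M) (\<lambda>(t, x). g (x(i := t)))"
    by (simp add: case_prod_beta')
  have eq: "integral\<^sup>L (PiM (insert i I) M) g = integral\<^sup>L (M i \<Otimes>\<^sub>M PiM I M) (\<lambda>(t, x). g (x(i := t)))"
    using assms by (subst D[symmetric], subst integral_distr[OF measurable_insert_coordinate])
      (auto simp: case_prod_beta')
  show "AE x in PiM I M. integrable (M i) (\<lambda>t. g (x(i := t)))"
    using A.AE_integrable_snd[OF int] .
  show "AE t in M i. integrable (PiM I M) (\<lambda>x. g (x(i := t)))"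
    using A.AE_integrable_fst[OF int] .
  show "integrable (M i) (\<lambda>t. \<integral>x. g (x(i := t)) \<partial>PiM I M)"
    using A.integrable_fst[OF int] .
  show "(\<integral>t. \<integral>x. g (x(i := t)) \<partial>PiM I M \<partial>M i) = integral\<^sup>L (PiM (insert i I) M) g"
    using A.integral_fst[OF int] eq by simp
  show "(\<integral>x. \<integral>t. g (x(i := t)) \<partial>M i \<partial>PiM I M) = integral\<^sup>L (PiM (insert i I) M) g"
    using A.integral_snd[OF int] eq by simp
qed

section \<open>Splicing two independent points of the full product\<close>

lemma measurable_merge_self:
  assumes "T \<subseteq> I"
  shows "merge T (I - T) \<in> PiM I M \<Otimes>\<^sub>M PiM I M \<rightarrow>\<^sub>M PiM I M"
proof -
  have "merge T (I - T) = (\<lambda>w::('i \<Rightarrow> 'a) \<times> ('i \<Rightarrow> 'a). \<lambda>j\<in>I. if j \<in> T then fst w j else snd w j)"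
    using assms by (auto simp: merge_def fun_eq_iff)
  moreover have "(\<lambda>w. \<lambda>j\<in>I. if j \<in> T then fst w j else snd w j) \<in> PiM I M \<Otimes>\<^sub>M PiM I M \<rightarrow>\<^sub>M PiM I M"
    by (rule measurable_restrict) auto
  ultimately show ?thesis by simp
qed

text \<open>On a box the preimage is a product of two boxes, and each coordinate is constrained in
  exactly one of them; the other factor has mass 1. Hence both points can be drawn from the full
  product, without separate measures for \<open>T\<close> and \<open>I - T\<close>.\<close>

lemma distr_merge_self:
  assumes "finite I" "T \<subseteq> I"
  shows "distr (PiM I M \<Otimes>\<^sub>M PiM I M) (PiM I M) (merge T (I - T)) = PiM I M"
proof (rule PiM_eqI)
  interpret J: prob_space "PiM I M" by (rule prob_space_Pi)
  fix A assume A: "\<And>i. i \<in> I \<Longrightarrow> A i \<in> sets (M i)"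
  let ?B = "\<lambda>i. if i \<in> T then A i else space (M i)" and ?C = "\<lambda>i. if i \<in> T then space (M i) else A i"
  have *: "merge T (I - T) -` Pi\<^sub>E I A \<inter> space (PiM I M \<Otimes>\<^sub>M PiM I M) = Pi\<^sub>E I ?B \<times> Pi\<^sub>E I ?C"
    using A[THEN sets.sets_into_space] assms(2)
    by (auto simp: space_PiM space_pair_measure merge_def PiE_iff extensional_def split: if_splits)
      (metis subsetD)+
  have "emeasure (distr (PiM I M \<Otimes>\<^sub>M PiM I M) (PiM I M) (merge T (I - T))) (Pi\<^sub>E I A)
      = emeasure (PiM I M) (Pi\<^sub>E I ?B) * emeasure (PiM I M) (Pi\<^sub>E I ?C)"
    using A assms by (simp add: emeasure_distr measurable_merge_self sets_PiM_I_finite *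
        J.emeasure_pair_measure_Times)
  also have "\<dots> = (\<Prod>i\<in>I. emeasure (M i) (?B i) * emeasure (M i) (?C i))"
    using A assms by (subst (1 2) emeasure_PiM) (auto simp: prod.distrib)
  also have "\<dots> = (\<Prod>i\<in>I. emeasure (M i) (A i))"
    by (intro prod.cong) (auto simp: prob_space.emeasure_space_1[OF prob_space_M])
  finally show "emeasure (distr (PiM I M \<Otimes>\<^sub>M PiM I M) (PiM I M) (merge T (I - T))) (Pi\<^sub>E I A)
      = (\<Prod>i\<in>I. emeasure (M i) (A i))" .
qed (use assms in simp_all)

lemma AE_merge:
  assumes "finite I" "T \<subseteq> I" "AE z in PiM I M. P z"
  shows "AE x in PiM I M. AE y in PiM I M. P (merge T (I - T) (x, y))"
proof -
  interpret pair_sigma_finite "PiM I M" "PiM I M" by (rule pair_sigma_finite_Pi)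
  have "AE w in PiM I M \<Otimes>\<^sub>M PiM I M. P (merge T (I - T) w)"
    by (rule AE_distrD[OF measurable_merge_self[OF assms(2)]], subst distr_merge_self)
      (use assms in simp_all)
  from AE_pair[OF this] show ?thesis .
qed

lemma nn_integral_merge:
  assumes "finite I" "T \<subseteq> I" "g \<in> borel_measurable (PiM I M)"
  shows "(\<integral>\<^sup>+x. \<integral>\<^sup>+y. g (merge T (I - T) (x, y)) \<partial>PiM I M \<partial>PiM I M) = integral\<^sup>N (PiM I M) g"
proof -
  interpret prob_space "PiM I M" by (rule prob_space_Pi)
  have "integral\<^sup>N (PiM I M) g = (\<integral>\<^sup>+w. g (merge T (I - T) w) \<partial>(PiM I M \<Otimes>\<^sub>M PiM I M))"
    using assms by (subst distr_merge_self[symmetric, of I T])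
      (auto simp: nn_integral_distr measurable_merge_self)
  also have "\<dots> = (\<integral>\<^sup>+x. \<integral>\<^sup>+y. g (merge T (I - T) (x, y)) \<partial>PiM I M \<partial>PiM I M)"
    by (rule nn_integral_fst[symmetric])
      (rule measurable_compose[OF measurable_merge_self[OF assms(2)] assms(3)])
  finally show ?thesis by simp
qed

text \<open>Translates between the definitions, which integrate over \<open>T\<close> or
  \<open>I - T\<close>, and the convention of integrating over all of \<open>I\<close>.\<close>

lemma nn_integral_Pi_restrict:
  assumes "finite I" "J \<subseteq> I" "g \<in> borel_measurable (PiM J M)" "\<And>x. g (restrict x J) = g x"
  shows "integral\<^sup>N (PiM J M) g = integral\<^sup>N (PiM I M) g"
  using assms by (subst distr_restrict[of J I]) (simp_all add: nn_integral_distr measurable_restrict_subset)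

lemma integral_Pi_restrict:
  fixes g :: "('i \<Rightarrow> 'a) \<Rightarrow> real"
  assumes "finite I" "J \<subseteq> I" "g \<in> borel_measurable (PiM J M)" "\<And>x. g (restrict x J) = g x"
  shows "integral\<^sup>L (PiM J M) g = integral\<^sup>L (PiM I M) g"
  using assms by (subst distr_restrict[of J I]) (simp_all add: integral_distr measurable_restrict_subset)

end

section \<open>Families of Efron--Stein type\<close>

text \<open>Abstracts the properties of S \<mapsto> f^{=S}, so that rescaled components and fibers
  over a coordinate are covered as well. Dependence on the coordinates in \<open>S\<close> is
  required at every point, which allows the other coordinates to be rewritten freely; the mean-zero
  property is only almost everywhere.\<close>

definition es_family ::
  "('i \<Rightarrow> 'a measure) \<Rightarrow> 'i set \<Rightarrow> ('i set \<Rightarrow> ('i \<Rightarrow> 'a) \<Rightarrow> real) \<Rightarrow> bool" where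
  "es_family M I F \<longleftrightarrow> (\<forall>S\<subseteq>I.
     (\<forall>x y. (\<forall>j\<in>S. x j = y j) \<longrightarrow> F S x = F S y) \<and>
     in_L2 (PiM I M) (F S) \<and>
     (\<forall>i\<in>S. AE x in PiM I M. (\<integral>t. F S (x(i := t)) \<partial>M i) = 0))"

text \<open>
  For an Efron--Stein family this is almost everywhere the squared norm of the derivative at \<open>x\<close>, by
  orthogonality; as a sum over components it is visibly monotone under rescaling of the components.
  Averaging over all coordinates instead of \<open>I - T\<close> changes nothing and avoids one measure per \<open>T\<close>.
\<close>

definition energy ::
  "('i \<Rightarrow> 'a measure) \<Rightarrow> 'i set \<Rightarrow> 'i set \<Rightarrow> ('i set \<Rightarrow> ('i \<Rightarrow> 'a) \<Rightarrow> real) \<Rightarrow> ('i \<Rightarrow> 'a) \<Rightarrow> ennreal" where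
  "energy M I T F x =
     (\<Sum>S | T \<subseteq> S \<and> S \<subseteq> I. \<integral>\<^sup>+y. ennreal ((F S (merge T (I - T) (x, y)))\<^sup>2) \<partial>PiM I M)"

text \<open>The noise operator \<open>T_\<rho>\<close> applied to the function with components
  \<open>F\<close>.\<close>

definition noise_sum :: "real \<Rightarrow> 'i set \<Rightarrow> ('i set \<Rightarrow> ('i \<Rightarrow> 'a) \<Rightarrow> real) \<Rightarrow> ('i \<Rightarrow> 'a) \<Rightarrow> real" where
  "noise_sum \<rho> I F x = (\<Sum>S\<in>Pow I. \<rho> ^ card S * F S x)"

text \<open>For \<open>i\<close> outside the index set, these are the components of the derivative
  \<open>D_{i,t}\<close>, indexed by the remaining coordinates.\<close>

definition fiber ::
  "('i set \<Rightarrow> ('i \<Rightarrow> 'a) \<Rightarrow> real) \<Rightarrow> 'i \<Rightarrow> 'a \<Rightarrow> 'i set \<Rightarrow> ('i \<Rightarrow> 'a) \<Rightarrow> real" where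
  "fiber F i t S x = F (insert i S) (x(i := t))"

lemma es_family_cong:
  "es_family M I F \<Longrightarrow> S \<subseteq> I \<Longrightarrow> (\<And>j. j \<in> S \<Longrightarrow> x j = y j) \<Longrightarrow> F S x = F S y"
  by (auto simp: es_family_def)

lemma es_family_upd:
  "es_family M I F \<Longrightarrow> S \<subseteq> I \<Longrightarrow> i \<notin> S \<Longrightarrow> F S (x(i := t)) = F S x"
  by (rule es_family_cong) auto

lemma es_family_measurable:
  "es_family M I F \<Longrightarrow> S \<subseteq> I \<Longrightarrow> F S \<in> borel_measurable (PiM I M)"
  by (auto simp: es_family_def in_L2_def)

lemma es_family_square_integrable:
  "es_family M I F \<Longrightarrow> S \<subseteq> I \<Longrightarrow> integrable (PiM I M) (\<lambda>x. (F S x)\<^sup>2)"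
  by (auto simp: es_family_def in_L2_def)

lemma es_family_mean_zero:
  "es_family M I F \<Longrightarrow> S \<subseteq> I \<Longrightarrow> i \<in> S \<Longrightarrow> AE x in PiM I M. (\<integral>t. F S (x(i := t)) \<partial>M i) = 0"
  by (auto simp: es_family_def)

section \<open>Splitting sums over subsets by membership of a new index\<close>

lemma subsets_insert_in:
  assumes "i \<notin> I" "T \<subseteq> I"
  shows "{S. insert i T \<subseteq> S \<and> S \<subseteq> insert i I} = insert i ` {S. T \<subseteq> S \<and> S \<subseteq> I}"
proof (intro equalityI subsetI)
  fix S assume S: "S \<in> {S. insert i T \<subseteq> S \<and> S \<subseteq> insert i I}"
  then have "S = insert i (S - {i})" "S - {i} \<in> {S. T \<subseteq> S \<and> S \<subseteq> I}" using assms by auto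
  then show "S \<in> insert i ` {S. T \<subseteq> S \<and> S \<subseteq> I}" by (rule image_eqI)
qed auto

lemma subsets_insert_notin:
  assumes "i \<notin> I" "T \<subseteq> I"
  shows "{S. T \<subseteq> S \<and> S \<subseteq> insert i I} = {S. T \<subseteq> S \<and> S \<subseteq> I} \<union> insert i ` {S. T \<subseteq> S \<and> S \<subseteq> I}"
  unfolding subsets_insert_in[OF assms, symmetric] using assms by auto

lemma inj_on_insert_subsets: "i \<notin> I \<Longrightarrow> inj_on (insert i) {S. T \<subseteq> S \<and> S \<subseteq> I}"
  by (rule inj_onI) (metis insert_ident mem_Collect_eq subsetD)

lemma inj_on_insert_Pow: "i \<notin> I \<Longrightarrow> inj_on (insert i) (Pow I)"
  using inj_on_insert_subsets[of i I "{}"] by (simp add: Pow_def)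

text \<open>The sets without \<open>i\<close> give the part constant in \<open>t\<close>. Those with
  \<open>i\<close> give the fiber, and their one additional element accounts for the factor
  \<rho>.\<close>

lemma noise_sum_insert:
  assumes F: "es_family M (insert i I) F" and I: "finite I" "i \<notin> I"
  shows "noise_sum \<rho> (insert i I) F (x(i := t)) = noise_sum \<rho> I F x + \<rho> * noise_sum \<rho> I (fiber F i t) x"
proof -
  have "noise_sum \<rho> (insert i I) F (x(i := t)) = (\<Sum>S\<in>Pow I. \<rho> ^ card S * F S (x(i := t)))
      + (\<Sum>S\<in>insert i ` Pow I. \<rho> ^ card S * F S (x(i := t)))"
    unfolding noise_sum_def Pow_insert using I by (intro sum.union_disjoint) auto
  also have "(\<Sum>S\<in>Pow I. \<rho> ^ card S * F S (x(i := t))) = noise_sum \<rho> I F x"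
    unfolding noise_sum_def using I(2)
    by (intro sum.cong refl arg_cong2[where f="(*)"] es_family_upd[OF F]) auto
  also have "(\<Sum>S\<in>insert i ` Pow I. \<rho> ^ card S * F S (x(i := t)))
      = (\<Sum>S\<in>Pow I. \<rho> ^ card (insert i S) * F (insert i S) (x(i := t)))"
    by (subst sum.reindex[OF inj_on_insert_Pow[OF I(2)]]) simp
  also have "\<dots> = \<rho> * noise_sum \<rho> I (fiber F i t) x"
    unfolding noise_sum_def sum_distrib_left
  proof (intro sum.cong refl)
    fix S assume "S \<in> Pow I"
    then have "finite S" "i \<notin> S" using I by (auto intro: finite_subset)
    then show "\<rho> ^ card (insert i S) * F (insert i S) (x(i := t)) = \<rho> * (\<rho> ^ card S * fiber F i t S x)"
      by (simp add: fiber_def)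
  qed
  finally show ?thesis .
qed

context prob_family
begin

section \<open>Removing a coordinate from a family\<close>

lemma measurable_fix_coordinate:
  "t \<in> space (M i) \<Longrightarrow> (\<lambda>x. x(i := t)) \<in> PiM I M \<rightarrow>\<^sub>M PiM (insert i I) M"
  using measurable_compose[OF measurable_Pair1' measurable_insert_coordinate] by simp

lemma ex_in_space_M: "\<exists>t. t \<in> space (M i)"
  using prob_space.not_empty[OF prob_space_M] by blast

text \<open>Fubini gives the claim for almost every \<open>t\<close>; as it does not involve
  \<open>t\<close> and \<open>M i\<close> has mass 1, it holds outright.\<close>

lemma AE_drop_coordinate:
  assumes "AE x in PiM (insert i I) M. P x" "\<And>x t. P (x(i := t)) \<longleftrightarrow> P x"
  shows "AE x in PiM I M. P x"
  using AE_insert_coordinate(1)[OF assms(1)] by (simp add: assms(2) prob_space.AE_const[OF prob_space_M])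

lemma es_family_integrable:
  assumes "es_family M I F" "S \<subseteq> I" shows "integrable (PiM I M) (F S)"
proof -
  interpret prob_space "PiM I M" by (rule prob_space_Pi)
  show ?thesis
    using es_family_measurable[OF assms] es_family_square_integrable[OF assms]
    by (rule square_integrable_imp_integrable)
qed

lemma es_family_drop:
  assumes F: "es_family M (insert i I) F" and i: "i \<notin> I"
  shows "es_family M I F"
  unfolding es_family_def
proof (intro allI impI conjI ballI)
  fix S assume S: "S \<subseteq> I"
  then have S': "S \<subseteq> insert i I" "i \<notin> S" using i by auto
  note upd = es_family_upd[OF F S']
  show "F S x = F S y" if "\<forall>j\<in>S. x j = y j" for x y
    using that S' by (intro es_family_cong[OF F]) auto
  \<comment> \<open>Any point serves: it lifts the smaller product into the larger one for the
    measurability claim, and \<open>F S\<close> ignores its value.\<close>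
  obtain t where t: "t \<in> space (M i)" using ex_in_space_M by blast
  have "integrable (PiM I M) (\<lambda>x. (F S x)\<^sup>2)"
    using integral_insert_coordinate(2)[OF es_family_square_integrable[OF F S'(1)]]
    by (simp add: upd prob_space.AE_const[OF prob_space_M])
  then show "in_L2 (PiM I M) (F S)"
    using measurable_compose[OF measurable_fix_coordinate[OF t] es_family_measurable[OF F S'(1)]]
    by (simp add: in_L2_def upd)
  fix j assume j: "j \<in> S"
  then have "j \<noteq> i" using S' by auto
  then have "F S (x(i := t, j := s)) = F S (x(j := s))" for x t s
    using upd[of "x(j := s)" t] by (simp add: fun_upd_twist)
  with es_family_mean_zero[OF F S'(1) j] show "AE x in PiM I M. (\<integral>t. F S (x(j := t)) \<partial>M j) = 0"
    by (elim AE_drop_coordinate) simp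
qed

text \<open>Square integrability and the mean-zero property pass to sections by Fubini, hence only
  for almost every \<open>t\<close>. There are finitely many \<open>S\<close> and \<open>j\<close>,
  so a single null set suffices.\<close>

lemma es_family_fiber:
  assumes F: "es_family M (insert i I) F" and I: "finite I" "i \<notin> I"
  shows "AE t in M i. es_family M I (fiber F i t)"
proof -
  have 1: "AE t in M i. \<forall>S\<in>Pow I. integrable (PiM I M) (\<lambda>x. (F (insert i S) (x(i := t)))\<^sup>2)"
    using I by (intro AE_finite_allI integral_insert_coordinate(2)[OF es_family_square_integrable[OF F]]) auto
  have 2: "AE t in M i. \<forall>S\<in>Pow I. \<forall>j\<in>S. AE x in PiM I M. (\<integral>s. F (insert i S) (x(i := t, j := s)) \<partial>M j) = 0"
    using I by (intro AE_finite_allI AE_insert_coordinate(1) es_family_mean_zero[OF F])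
      (auto intro: finite_subset)
  from 1 2 AE_space show ?thesis
  proof eventually_elim
    case (elim t)
    show ?case
      unfolding es_family_def
    proof (intro allI impI conjI ballI)
      fix S assume S: "S \<subseteq> I"
      then have S': "insert i S \<subseteq> insert i I" by auto
      show "fiber F i t S x = fiber F i t S y" if "\<forall>j\<in>S. x j = y j" for x y
        unfolding fiber_def using that by (intro es_family_cong[OF F S']) auto
      show "in_L2 (PiM I M) (fiber F i t S)"
        using elim S measurable_compose[OF measurable_fix_coordinate es_family_measurable[OF F S']]
        by (auto simp: in_L2_def fiber_def[abs_def])
      fix j assume j: "j \<in> S"
      then have "j \<noteq> i" using S I by auto
      then have "x(j := s, i := t) = x(i := t, j := s)" for x :: "'i \<Rightarrow> 'a" and s
        by (simp add: fun_upd_twist)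
      then show "AE x in PiM I M. (\<integral>s. fiber F i t S (x(j := s)) \<partial>M j) = 0"
        using elim(2) S j by (simp add: fiber_def)
    qed
  qed
qed

lemma fiber_mean_zero:
  assumes F: "es_family M (insert i I) F" and S: "S \<subseteq> I"
  shows "AE x in PiM I M. integrable (M i) (\<lambda>t. fiber F i t S x) \<and> (\<integral>t. fiber F i t S x \<partial>M i) = 0"
proof -
  have S': "insert i S \<subseteq> insert i I" using S by auto
  have "AE x in PiM I M. (\<integral>t. F (insert i S) (x(i := t)) \<partial>M i) = 0"
    using es_family_mean_zero[OF F S'] by (rule AE_drop_coordinate) auto
  with integral_insert_coordinate(1)[OF es_family_integrable[OF F S']] show ?thesis
    by eventually_elim (auto simp: fiber_def)
qed

text \<open>Supplies the hypotheses on \<open>h\<close> and \<open>k\<close> in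
  \<open>nn_integral_quartic_le\<close> at almost every \<open>x\<close>.\<close>

lemma noise_sum_fiber_mean_zero:
  assumes F: "es_family M (insert i I) F" and I: "finite I"
  shows "AE x in PiM I M. integrable (M i) (\<lambda>t. noise_sum \<rho> I (fiber F i t) x)
    \<and> (\<integral>t. noise_sum \<rho> I (fiber F i t) x \<partial>M i) = 0"
proof -
  have "AE x in PiM I M. \<forall>S\<in>Pow I. integrable (M i) (\<lambda>t. fiber F i t S x) \<and> (\<integral>t. fiber F i t S x \<partial>M i) = 0"
    using I by (intro AE_finite_allI fiber_mean_zero[OF F]) auto
  then show ?thesis
    by eventually_elim (auto simp: noise_sum_def intro!: sum.neutral)
qed

section \<open>Energies: measurability and dependence on one coordinate\<close>

lemma measurable_merge_section:
  assumes "G \<in> borel_measurable (PiM I M)" "T \<subseteq> I" "x \<in> space (PiM I M)"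
  shows "(\<lambda>y. G (merge T (I - T) (x, y))) \<in> borel_measurable (PiM I M)"
  using measurable_compose[OF measurable_Pair1'[OF assms(3)]
      measurable_compose[OF measurable_merge_self[OF assms(2)] assms(1)]] .

lemma measurable_merge_insert:
  assumes G: "G \<in> borel_measurable (PiM (insert i I) M)" and "T \<subseteq> I"
  shows "(\<lambda>((t, x), y). G ((merge T (I - T) (x, y))(i := t))) \<in> borel_measurable ((M i \<Otimes>\<^sub>M PiM I M) \<Otimes>\<^sub>M PiM I M)"
proof -
  note [measurable] = measurable_merge_self[OF assms(2)]
  have "(\<lambda>w. (fst (fst w), merge T (I - T) (snd (fst w), snd w)))
      \<in> (M i \<Otimes>\<^sub>M PiM I M) \<Otimes>\<^sub>M PiM I M \<rightarrow>\<^sub>M M i \<Otimes>\<^sub>M PiM I M"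
    by measurable
  from measurable_compose[OF measurable_compose[OF this measurable_insert_coordinate] G]
  show ?thesis by (simp add: case_prod_beta')
qed

lemma energy_measurable:
  assumes F: "es_family M I F" and T: "T \<subseteq> I"
  shows "energy M I T F \<in> borel_measurable (PiM I M)"
proof -
  interpret prob_space "PiM I M" by (rule prob_space_Pi)
  have [measurable]: "(\<lambda>(x, y). F S (merge T (I - T) (x, y))) \<in> borel_measurable (PiM I M \<Otimes>\<^sub>M PiM I M)"
    if "S \<subseteq> I" for S
    using measurable_compose[OF measurable_merge_self[OF T] es_family_measurable[OF F that]] by simp
  show ?thesis
    unfolding energy_def[abs_def] by (intro borel_measurable_sum borel_measurable_nn_integral) measurable
qed

lemma energy_fiber_measurable:
  assumes F: "es_family M (insert i I) F" and T: "T \<subseteq> I"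
  shows "(\<lambda>(t, x). energy M I T (fiber F i t) x) \<in> borel_measurable (M i \<Otimes>\<^sub>M PiM I M)"
proof -
  interpret prob_space "PiM I M" by (rule prob_space_Pi)
  have [measurable]: "(\<lambda>(w, y). F (insert i S) ((merge T (I - T) (snd w, y))(i := fst w)))
      \<in> borel_measurable ((M i \<Otimes>\<^sub>M PiM I M) \<Otimes>\<^sub>M PiM I M)" if "S \<subseteq> I" for S
    using measurable_merge_insert[OF es_family_measurable[OF F] T, of "insert i S"] that
    by (auto simp: case_prod_beta')
  show ?thesis
    unfolding energy_def fiber_def case_prod_beta'
    by (intro borel_measurable_sum borel_measurable_nn_integral) measurable
qed

lemma noise_sum_measurable:
  assumes F: "es_family M I F"
  shows "noise_sum \<rho> I F \<in> borel_measurable (PiM I M)"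
  unfolding noise_sum_def[abs_def]
  by (intro borel_measurable_sum borel_measurable_times es_family_measurable[OF F]) auto

lemma noise_sum_fiber_measurable:
  assumes F: "es_family M (insert i I) F"
  shows "(\<lambda>(t, x). noise_sum \<rho> I (fiber F i t) x) \<in> borel_measurable (M i \<Otimes>\<^sub>M PiM I M)"
proof -
  have [measurable]: "(\<lambda>w. F (insert i S) ((snd w)(i := fst w))) \<in> borel_measurable (M i \<Otimes>\<^sub>M PiM I M)"
    if "S \<subseteq> I" for S
    using measurable_compose[OF measurable_insert_coordinate es_family_measurable[OF F, of "insert i S"]] that
    by (auto simp: case_prod_beta')
  show ?thesis
    unfolding noise_sum_def fiber_def case_prod_beta'
    by (intro borel_measurable_sum borel_measurable_times) auto
qed

text \<open>Since \<open>i\<close> is not in \<open>T\<close>, coordinate \<open>i\<close> is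
  averaged and the value \<open>s\<close> is overwritten. Sets without \<open>i\<close> contribute
  the old energy, and sets with \<open>i\<close> contribute the mean energy of the fibers.\<close>

lemma energy_insert_notin:
  assumes F: "es_family M (insert i I) F" and I: "finite I" "i \<notin> I" and T: "T \<subseteq> I"
    and x: "x \<in> space (PiM I M)" and s: "s \<in> space (M i)"
  shows "energy M (insert i I) T F (x(i := s)) = energy M I T F x + (\<integral>\<^sup>+t. energy M I T (fiber F i t) x \<partial>M i)"
proof -
  let ?\<S> = "{S. T \<subseteq> S \<and> S \<subseteq> I}" and ?J = "insert i I"
  let ?A = "\<lambda>S. \<integral>\<^sup>+y. ennreal ((F S (merge T (?J - T) (x(i := s), y)))\<^sup>2) \<partial>PiM ?J M"
  have fin: "finite ?\<S>" using I by auto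
  have iT: "i \<notin> T" using T I by auto
  have xs: "x(i := s) \<in> space (PiM ?J M)"
    using x s by (auto simp: space_PiM PiE_iff extensional_def)
  have merge: "merge T (?J - T) (x(i := s), y(i := t)) = (merge T (I - T) (x, y))(i := t)" for y t
    using iT I by (auto simp: merge_def fun_eq_iff)
  have meas: "(\<lambda>y. ennreal ((F S (merge T (?J - T) (x(i := s), y)))\<^sup>2)) \<in> borel_measurable (PiM ?J M)"
    if "S \<subseteq> ?J" for S
    using measurable_merge_section[OF es_family_measurable[OF F that] _ xs, of T] T
    by (intro measurable_compose[OF _ measurable_ennreal] borel_measurable_power) auto
  have one: "?A S = (\<integral>\<^sup>+y. ennreal ((F S (merge T (I - T) (x, y)))\<^sup>2) \<partial>PiM I M)" if "S \<subseteq> I" for S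
  proof -
    have "S \<subseteq> ?J" "i \<notin> S" using that I by auto
    then show ?thesis
      using I by (subst product_nn_integral_insert[OF I meas])
        (simp_all add: merge es_family_upd[OF F] prob_space.emeasure_space_1[OF prob_space_M])
  qed
  \<comment> \<open>Here \<open>t\<close> is integrated last, so that the inner integral is a term
    of the energy of the fiber at \<open>t\<close>.\<close>
  have two: "?A (insert i S)
      = (\<integral>\<^sup>+t. \<integral>\<^sup>+y. ennreal ((fiber F i t S (merge T (I - T) (x, y)))\<^sup>2) \<partial>PiM I M \<partial>M i)" if "S \<subseteq> I" for S
  proof -
    have "insert i S \<subseteq> ?J" using that by auto
    then show ?thesis
      using I by (subst product_nn_integral_insert_rev[OF I meas]) (simp_all add: merge fiber_def)
  qed
  have inner: "(\<lambda>t. \<integral>\<^sup>+y. ennreal ((fiber F i t S (merge T (I - T) (x, y)))\<^sup>2) \<partial>PiM I M) \<in> borel_measurable (M i)"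
    if "S \<subseteq> I" for S
  proof -
    interpret prob_space "PiM I M" by (rule prob_space_Pi)
    have "(\<lambda>w. ((fst w, x), snd w)) \<in> M i \<Otimes>\<^sub>M PiM I M \<rightarrow>\<^sub>M (M i \<Otimes>\<^sub>M PiM I M) \<Otimes>\<^sub>M PiM I M"
      using x by measurable
    from measurable_compose[OF this measurable_merge_insert[OF es_family_measurable[OF F, of "insert i S"] T]] that
    have [measurable]: "(\<lambda>(t, y). F (insert i S) ((merge T (I - T) (x, y))(i := t))) \<in> borel_measurable (M i \<Otimes>\<^sub>M PiM I M)"
      by (auto simp: case_prod_beta')
    show ?thesis unfolding fiber_def by measurable
  qed
  have "energy M ?J T F (x(i := s)) = (\<Sum>S\<in>?\<S>. ?A S) + (\<Sum>S\<in>insert i ` ?\<S>. ?A S)"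
    unfolding energy_def subsets_insert_notin[OF I(2) T] using fin I
    by (intro sum.union_disjoint) auto
  also have "(\<Sum>S\<in>?\<S>. ?A S) = energy M I T F x"
    unfolding energy_def by (intro sum.cong refl one) auto
  also have "(\<Sum>S\<in>insert i ` ?\<S>. ?A S) = (\<Sum>S\<in>?\<S>. ?A (insert i S))"
    by (subst sum.reindex[OF inj_on_insert_subsets[OF I(2)]]) simp
  also have "\<dots> = (\<Sum>S\<in>?\<S>. \<integral>\<^sup>+t. \<integral>\<^sup>+y. ennreal ((fiber F i t S (merge T (I - T) (x, y)))\<^sup>2) \<partial>PiM I M \<partial>M i)"
    by (intro sum.cong refl two) auto
  also have "\<dots> = (\<integral>\<^sup>+t. energy M I T (fiber F i t) x \<partial>M i)"
    unfolding energy_def using inner by (subst nn_integral_sum) auto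
  finally show ?thesis .
qed

text \<open>Now coordinate \<open>i\<close> is read from the point and stays at \<open>t\<close>,
  and every set in the sum contains \<open>i\<close>. Integrating the resampled coordinate
  \<open>i\<close> is integrating a constant.\<close>

lemma energy_insert_in:
  assumes F: "es_family M (insert i I) F" and I: "finite I" "i \<notin> I" and T: "T \<subseteq> I"
    and x: "x \<in> space (PiM I M)" and t: "t \<in> space (M i)"
  shows "energy M (insert i I) (insert i T) F (x(i := t)) = energy M I T (fiber F i t) x"
proof -
  let ?\<S> = "{S. T \<subseteq> S \<and> S \<subseteq> I}" and ?J = "insert i I"
  let ?A = "\<lambda>S. \<integral>\<^sup>+y. ennreal ((F S (merge (insert i T) (?J - insert i T) (x(i := t), y)))\<^sup>2) \<partial>PiM ?J M"
  have xt: "x(i := t) \<in> space (PiM ?J M)"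
    using x t by (auto simp: space_PiM PiE_iff extensional_def)
  have merge: "merge (insert i T) (insert i I - insert i T) (x(i := t), y(i := s)) = (merge T (I - T) (x, y))(i := t)" for y s
    using I T by (auto simp: merge_def fun_eq_iff)
  have A: "?A (insert i S) = (\<integral>\<^sup>+y. ennreal ((fiber F i t S (merge T (I - T) (x, y)))\<^sup>2) \<partial>PiM I M)" if "S \<subseteq> I" for S
  proof -
    have S: "insert i S \<subseteq> ?J" using that by auto
    have meas: "(\<lambda>y. ennreal ((F (insert i S) (merge (insert i T) (?J - insert i T) (x(i := t), y)))\<^sup>2))
        \<in> borel_measurable (PiM ?J M)"
      using measurable_merge_section[OF es_family_measurable[OF F S] _ xt, of "insert i T"] T
      by (intro measurable_compose[OF _ measurable_ennreal] borel_measurable_power) auto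
    show ?thesis
      by (subst product_nn_integral_insert[OF I meas])
        (simp_all only: merge fiber_def prob_space.emeasure_space_1[OF prob_space_M]
          nn_integral_const mult_1_right)
  qed
  have "energy M ?J (insert i T) F (x(i := t)) = (\<Sum>S\<in>?\<S>. ?A (insert i S))"
    unfolding energy_def subsets_insert_in[OF I(2) T]
    by (subst sum.reindex[OF inj_on_insert_subsets[OF I(2)]]) simp
  also have "\<dots> = energy M I T (fiber F i t) x"
    unfolding energy_def by (intro sum.cong refl A) auto
  finally show ?thesis .
qed

section \<open>The noise inequality by induction on the coordinates\<close>

lemma nn_integral_swap:
  assumes "(\<lambda>(t, x). u t x) \<in> borel_measurable (M i \<Otimes>\<^sub>M PiM I M)"
  shows "(\<integral>\<^sup>+t. \<integral>\<^sup>+x. u t x \<partial>PiM I M \<partial>M i) = (\<integral>\<^sup>+x. \<integral>\<^sup>+t. u t x \<partial>M i \<partial>PiM I M)"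
    and "(\<lambda>x. \<integral>\<^sup>+t. u t x \<partial>M i) \<in> borel_measurable (PiM I M)"
    and "(\<lambda>t. \<integral>\<^sup>+x. u t x \<partial>PiM I M) \<in> borel_measurable (M i)"
proof -
  interpret A: pair_sigma_finite "M i" "PiM I M" by (rule pair_sigma_finite_Pi)
  show "(\<integral>\<^sup>+t. \<integral>\<^sup>+x. u t x \<partial>PiM I M \<partial>M i) = (\<integral>\<^sup>+x. \<integral>\<^sup>+t. u t x \<partial>M i \<partial>PiM I M)"
    using A.Fubini'[OF assms] by simp
  show "(\<lambda>x. \<integral>\<^sup>+t. u t x \<partial>M i) \<in> borel_measurable (PiM I M)"
    using assms measurable_pair_swap[OF assms]
    by (intro sigma_finite_measure.borel_measurable_nn_integral[OF prob_space_imp_sigma_finite[OF prob_space_M]]) (simp add: case_prod_beta')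
  show "(\<lambda>t. \<integral>\<^sup>+x. u t x \<partial>PiM I M) \<in> borel_measurable (M i)"
    using assms by (intro sigma_finite_measure.borel_measurable_nn_integral[OF prob_space_imp_sigma_finite[OF prob_space_Pi]]) (simp add: case_prod_beta')
qed

lemma nn_integral_sum_swap:
  fixes c :: "'i set \<Rightarrow> ennreal"
  assumes "\<And>T. T \<in> A \<Longrightarrow> (\<lambda>(t, x). u T t x) \<in> borel_measurable (M i \<Otimes>\<^sub>M PiM I M)"
  shows "(\<integral>\<^sup>+t. (\<Sum>T\<in>A. c T * (\<integral>\<^sup>+x. u T t x \<partial>PiM I M)) \<partial>M i)
    = (\<Sum>T\<in>A. c T * (\<integral>\<^sup>+x. \<integral>\<^sup>+t. u T t x \<partial>M i \<partial>PiM I M))"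
  using nn_integral_swap[OF assms] by (simp add: nn_integral_sum nn_integral_cmult)

theorem noise_sum_fourth_moment_le:
  fixes \<rho> \<delta> \<beta> :: real
  assumes par: "0 \<le> \<rho>" "0 < \<delta>" "3 * \<rho>\<^sup>2 + \<delta> \<le> 1" "\<rho> ^ 4 + 2 * \<rho> ^ 6 / \<delta> \<le> \<beta>"
    and "finite I" "es_family M I F" "es_family M I G"
  shows "(\<integral>\<^sup>+x. ennreal ((noise_sum \<rho> I F x)\<^sup>2 * (noise_sum \<rho> I G x)\<^sup>2) \<partial>PiM I M)
    \<le> (\<Sum>T\<in>Pow I. ennreal \<beta> ^ card T * (\<integral>\<^sup>+x. energy M I T F x * energy M I T G x \<partial>PiM I M))"
  using assms(5-)
proof (induction I arbitrary: F G rule: finite_induct)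
  \<comment> \<open>The empty product has a single point, and both sides are the product of the
    squares of the empty components there.\<close>
  case empty
  have "{S. S \<subseteq> ({} :: 'i set)} = {{}}" by auto
  moreover have "merge {} {} (x, y) = (\<lambda>k. undefined)" for x y :: "'i \<Rightarrow> 'a"
    by (simp add: merge_def)
  ultimately show ?case
    by (simp add: nn_integral_empty noise_sum_def energy_def ennreal_mult
        prob_space.emeasure_space_1[OF prob_space_Pi])
next
  case (insert i I)
  note I = \<open>finite I\<close> \<open>i \<notin> I\<close> and F = \<open>es_family M (insert i I) F\<close> and G = \<open>es_family M (insert i I) G\<close>
  interpret PI: prob_space "PiM I M" by (rule prob_space_Pi)
  note F' = es_family_drop[OF F I(2)] and G' = es_family_drop[OF G I(2)]
  define a b where "a = noise_sum \<rho> I F" and "b = noise_sum \<rho> I G"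
  define h k where "h t = noise_sum \<rho> I (fiber F i t)" and "k t = noise_sum \<rho> I (fiber G i t)" for t
  \<comment> \<open>\<open>eF\<close>, \<open>eG\<close> are energies of the parts free of
    coordinate \<open>i\<close>; \<open>fF\<close>, \<open>fG\<close> are those of the fibers at
    \<open>t\<close>.\<close>
  define eF eG where "eF T = energy M I T F" and "eG T = energy M I T G" for T
  define fF fG where "fF T t = energy M I T (fiber F i t)" and "fG T t = energy M I T (fiber G i t)" for T t
  have [measurable]: "a \<in> borel_measurable (PiM I M)" "b \<in> borel_measurable (PiM I M)"
    unfolding a_def b_def by (intro noise_sum_measurable F' G')+
  have hk[measurable]: "(\<lambda>(t, x). h t x) \<in> borel_measurable (M i \<Otimes>\<^sub>M PiM I M)"
    "(\<lambda>(t, x). k t x) \<in> borel_measurable (M i \<Otimes>\<^sub>M PiM I M)"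
    unfolding h_def k_def by (intro noise_sum_fiber_measurable F G)+
  have e[measurable]: "eF T \<in> borel_measurable (PiM I M)" "eG T \<in> borel_measurable (PiM I M)" if "T \<subseteq> I" for T
    unfolding eF_def eG_def using that by (intro energy_measurable F' G'; simp)+
  have f[measurable]: "(\<lambda>(t, x). fF T t x) \<in> borel_measurable (M i \<Otimes>\<^sub>M PiM I M)"
    "(\<lambda>(t, x). fG T t x) \<in> borel_measurable (M i \<Otimes>\<^sub>M PiM I M)" if "T \<subseteq> I" for T
    unfolding fF_def fG_def using that by (intro energy_fiber_measurable F G; simp)+
  have f_t: "(\<lambda>t. fF T t x) \<in> borel_measurable (M i)" "(\<lambda>t. fG T t x) \<in> borel_measurable (M i)"
    if "T \<subseteq> I" "x \<in> space (PiM I M)" for T x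
    using measurable_compose[OF measurable_Pair2'[OF that(2)] f(1)[OF that(1)]]
      measurable_compose[OF measurable_Pair2'[OF that(2)] f(2)[OF that(1)]] by simp_all
  let ?ak = "\<lambda>t x. ennreal ((a x)\<^sup>2 * (k t x)\<^sup>2)" and ?hb = "\<lambda>t x. ennreal ((h t x)\<^sup>2 * (b x)\<^sup>2)"
    and ?hk = "\<lambda>t x. ennreal ((h t x)\<^sup>2 * (k t x)\<^sup>2)"
  have m: "(\<lambda>(t, x). ?ak t x) \<in> borel_measurable (M i \<Otimes>\<^sub>M PiM I M)"
    "(\<lambda>(t, x). ?hb t x) \<in> borel_measurable (M i \<Otimes>\<^sub>M PiM I M)"
    "(\<lambda>(t, x). ?hk t x) \<in> borel_measurable (M i \<Otimes>\<^sub>M PiM I M)"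
    by measurable
  note [measurable] = nn_integral_swap(2)[OF m(1)] nn_integral_swap(2)[OF m(2)] nn_integral_swap(2)[OF m(3)]
  have noise: "noise_sum \<rho> (insert i I) F (x(i := t)) = a x + \<rho> * h t x"
    "noise_sum \<rho> (insert i I) G (x(i := t)) = b x + \<rho> * k t x" for x t
    unfolding a_def b_def h_def k_def by (rule noise_sum_insert[OF F I] noise_sum_insert[OF G I])+
  have meas: "(\<lambda>x. ennreal ((noise_sum \<rho> (insert i I) F x)\<^sup>2 * (noise_sum \<rho> (insert i I) G x)\<^sup>2))
      \<in> borel_measurable (PiM (insert i I) M)"
    using noise_sum_measurable[OF F, of \<rho>] noise_sum_measurable[OF G, of \<rho>] by measurable
  have "(\<integral>\<^sup>+x. ennreal ((noise_sum \<rho> (insert i I) F x)\<^sup>2 * (noise_sum \<rho> (insert i I) G x)\<^sup>2) \<partial>PiM (insert i I) M)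
      = (\<integral>\<^sup>+x. \<integral>\<^sup>+t. ennreal ((a x + \<rho> * h t x)\<^sup>2 * (b x + \<rho> * k t x)\<^sup>2) \<partial>M i \<partial>PiM I M)"
    by (subst product_nn_integral_insert[OF I meas]) (simp add: noise)
  also have "\<dots> \<le> (\<integral>\<^sup>+x. ennreal ((a x)\<^sup>2 * (b x)\<^sup>2) + (\<integral>\<^sup>+t. ?ak t x \<partial>M i) + (\<integral>\<^sup>+t. ?hb t x \<partial>M i)
      + ennreal \<beta> * (\<integral>\<^sup>+t. ?hk t x \<partial>M i) \<partial>PiM I M)"
  proof (rule nn_integral_mono_AE)
    from noise_sum_fiber_mean_zero[OF F I(1), of \<rho>] noise_sum_fiber_mean_zero[OF G I(1), of \<rho>]
    show "AE x in PiM I M. (\<integral>\<^sup>+t. ennreal ((a x + \<rho> * h t x)\<^sup>2 * (b x + \<rho> * k t x)\<^sup>2) \<partial>M i)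
      \<le> ennreal ((a x)\<^sup>2 * (b x)\<^sup>2) + (\<integral>\<^sup>+t. ?ak t x \<partial>M i) + (\<integral>\<^sup>+t. ?hb t x \<partial>M i)
        + ennreal \<beta> * (\<integral>\<^sup>+t. ?hk t x \<partial>M i)"
      by eventually_elim
        (rule prob_space.nn_integral_quartic_le[OF prob_space_M par], auto simp: h_def k_def)
  qed
  \<comment> \<open>The order of integration is exchanged because the induction hypothesis
    integrates over \<open>x\<close> with \<open>t\<close> fixed.\<close>
  also have "\<dots> = (\<integral>\<^sup>+x. ennreal ((a x)\<^sup>2 * (b x)\<^sup>2) \<partial>PiM I M) + (\<integral>\<^sup>+t. \<integral>\<^sup>+x. ?ak t x \<partial>PiM I M \<partial>M i)
      + (\<integral>\<^sup>+t. \<integral>\<^sup>+x. ?hb t x \<partial>PiM I M \<partial>M i) + ennreal \<beta> * (\<integral>\<^sup>+t. \<integral>\<^sup>+x. ?hk t x \<partial>PiM I M \<partial>M i)"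
    unfolding nn_integral_swap(1)[OF m(1)] nn_integral_swap(1)[OF m(2)] nn_integral_swap(1)[OF m(3)]
    by (simp add: nn_integral_add nn_integral_cmult)
  \<comment> \<open>The induction hypothesis is used for four pairs: \<open>F\<close> or its fiber
    with \<open>G\<close> or its fiber. Where a fiber occurs it applies for almost every
    \<open>t\<close>.\<close>
  also have "\<dots> \<le> (\<Sum>T\<in>Pow I. ennreal \<beta> ^ card T * (\<integral>\<^sup>+x. eF T x * eG T x \<partial>PiM I M))
      + (\<integral>\<^sup>+t. (\<Sum>T\<in>Pow I. ennreal \<beta> ^ card T * (\<integral>\<^sup>+x. eF T x * fG T t x \<partial>PiM I M)) \<partial>M i)
      + (\<integral>\<^sup>+t. (\<Sum>T\<in>Pow I. ennreal \<beta> ^ card T * (\<integral>\<^sup>+x. fF T t x * eG T x \<partial>PiM I M)) \<partial>M i)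
      + ennreal \<beta> * (\<integral>\<^sup>+t. (\<Sum>T\<in>Pow I. ennreal \<beta> ^ card T * (\<integral>\<^sup>+x. fF T t x * fG T t x \<partial>PiM I M)) \<partial>M i)"
    unfolding a_def b_def h_def k_def eF_def eG_def fF_def fG_def
    by (intro add_mono mult_left_mono nn_integral_mono_AE insert.IH F' G'
        eventually_mono[OF eventually_conj[OF es_family_fiber[OF F I] es_family_fiber[OF G I]]]) auto
  also have "\<dots> = (\<Sum>T\<in>Pow I. ennreal \<beta> ^ card T * (\<integral>\<^sup>+x. eF T x * eG T x \<partial>PiM I M))
      + (\<Sum>T\<in>Pow I. ennreal \<beta> ^ card T * (\<integral>\<^sup>+x. \<integral>\<^sup>+t. eF T x * fG T t x \<partial>M i \<partial>PiM I M))
      + (\<Sum>T\<in>Pow I. ennreal \<beta> ^ card T * (\<integral>\<^sup>+x. \<integral>\<^sup>+t. fF T t x * eG T x \<partial>M i \<partial>PiM I M))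
      + ennreal \<beta> * (\<Sum>T\<in>Pow I. ennreal \<beta> ^ card T * (\<integral>\<^sup>+x. \<integral>\<^sup>+t. fF T t x * fG T t x \<partial>M i \<partial>PiM I M))"
    by (intro arg_cong2[where f="(+)"] arg_cong2[where f="(*)"] nn_integral_sum_swap refl) measurable
  also have "\<dots> = (\<Sum>T\<in>Pow I. ennreal \<beta> ^ card T *
      ((\<integral>\<^sup>+x. eF T x * eG T x \<partial>PiM I M) + (\<integral>\<^sup>+x. \<integral>\<^sup>+t. eF T x * fG T t x \<partial>M i \<partial>PiM I M)
        + (\<integral>\<^sup>+x. \<integral>\<^sup>+t. fF T t x * eG T x \<partial>M i \<partial>PiM I M)
        + ennreal \<beta> * (\<integral>\<^sup>+x. \<integral>\<^sup>+t. fF T t x * fG T t x \<partial>M i \<partial>PiM I M)))"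
    by (simp add: distrib_left sum.distrib sum_distrib_left mult_ac)
  \<comment> \<open>The first three products are charged to \<open>T\<close> and the last, with its
    factor \<beta>, to \<open>insert i T\<close>.\<close>
  also have "\<dots> \<le> (\<Sum>T\<in>Pow I. ennreal \<beta> ^ card T *
      ((\<integral>\<^sup>+x. energy M (insert i I) T F x * energy M (insert i I) T G x \<partial>PiM (insert i I) M)
        + ennreal \<beta> * (\<integral>\<^sup>+x. energy M (insert i I) (insert i T) F x * energy M (insert i I) (insert i T) G x
            \<partial>PiM (insert i I) M)))"
  proof (intro sum_mono mult_left_mono add_mono)
    fix T assume "T \<in> Pow I"
    then have T: "T \<subseteq> I" "T \<subseteq> insert i I" "insert i T \<subseteq> insert i I" by auto
    note [measurable] = e[OF T(1)] f[OF T(1)] nn_integral_swap(2)[OF f(1)[OF T(1)]] nn_integral_swap(2)[OF f(2)[OF T(1)]]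
    have 1: "(\<integral>\<^sup>+t. eF T x * fG T t x \<partial>M i) = eF T x * (\<integral>\<^sup>+t. fG T t x \<partial>M i)"
      "(\<integral>\<^sup>+t. fF T t x * eG T x \<partial>M i) = (\<integral>\<^sup>+t. fF T t x \<partial>M i) * eG T x" if "x \<in> space (PiM I M)" for x
      using f_t[OF T(1) that] by (simp_all add: nn_integral_cmult nn_integral_multc)
    have "(\<integral>\<^sup>+x. eF T x * eG T x \<partial>PiM I M) + (\<integral>\<^sup>+x. \<integral>\<^sup>+t. eF T x * fG T t x \<partial>M i \<partial>PiM I M)
        + (\<integral>\<^sup>+x. \<integral>\<^sup>+t. fF T t x * eG T x \<partial>M i \<partial>PiM I M)
      = (\<integral>\<^sup>+x. eF T x * eG T x + eF T x * (\<integral>\<^sup>+t. fG T t x \<partial>M i) + (\<integral>\<^sup>+t. fF T t x \<partial>M i) * eG T x \<partial>PiM I M)"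
      by (simp add: nn_integral_add 1 cong: nn_integral_cong)
    \<comment> \<open>The product of the mean fiber energies is missing on the left; being
      nonnegative, it may be added to complete the factorization.\<close>
    also have "\<dots> \<le> (\<integral>\<^sup>+x. (eF T x + (\<integral>\<^sup>+t. fF T t x \<partial>M i)) * (eG T x + (\<integral>\<^sup>+t. fG T t x \<partial>M i)) \<partial>PiM I M)"
      by (intro nn_integral_mono) (simp add: distrib_left distrib_right add_ac add_increasing2 add_left_mono)
    \<comment> \<open>The integral over \<open>s\<close> of a constant is introduced so that both
      integrals combine into one over \<open>insert i I\<close>.\<close>
    also have "\<dots> = (\<integral>\<^sup>+x. \<integral>\<^sup>+s. (eF T x + (\<integral>\<^sup>+t. fF T t x \<partial>M i)) * (eG T x + (\<integral>\<^sup>+t. fG T t x \<partial>M i)) \<partial>M i \<partial>PiM I M)"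
      by (simp add: prob_space.emeasure_space_1[OF prob_space_M])
    also have "\<dots> = (\<integral>\<^sup>+x. \<integral>\<^sup>+s. energy M (insert i I) T F (x(i := s)) * energy M (insert i I) T G (x(i := s)) \<partial>M i \<partial>PiM I M)"
      unfolding eF_def eG_def fF_def fG_def
      by (intro nn_integral_cong) (simp add: energy_insert_notin[OF F I T(1)] energy_insert_notin[OF G I T(1)])
    also have "\<dots> = (\<integral>\<^sup>+x. energy M (insert i I) T F x * energy M (insert i I) T G x \<partial>PiM (insert i I) M)"
      by (rule product_nn_integral_insert[OF I, symmetric])
        (intro borel_measurable_times_ennreal energy_measurable F G T)
    finally show "(\<integral>\<^sup>+x. eF T x * eG T x \<partial>PiM I M) + (\<integral>\<^sup>+x. \<integral>\<^sup>+t. eF T x * fG T t x \<partial>M i \<partial>PiM I M)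
        + (\<integral>\<^sup>+x. \<integral>\<^sup>+t. fF T t x * eG T x \<partial>M i \<partial>PiM I M)
      \<le> (\<integral>\<^sup>+x. energy M (insert i I) T F x * energy M (insert i I) T G x \<partial>PiM (insert i I) M)" .
    have "(\<integral>\<^sup>+x. \<integral>\<^sup>+t. fF T t x * fG T t x \<partial>M i \<partial>PiM I M)
      = (\<integral>\<^sup>+x. \<integral>\<^sup>+t. energy M (insert i I) (insert i T) F (x(i := t)) *
            energy M (insert i I) (insert i T) G (x(i := t)) \<partial>M i \<partial>PiM I M)"
      unfolding fF_def fG_def
      by (intro nn_integral_cong) (simp add: energy_insert_in[OF F I T(1)] energy_insert_in[OF G I T(1)])
    also have "\<dots> = (\<integral>\<^sup>+x. energy M (insert i I) (insert i T) F x * energy M (insert i I) (insert i T) G x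
            \<partial>PiM (insert i I) M)"
      by (rule product_nn_integral_insert[OF I, symmetric])
        (intro borel_measurable_times_ennreal energy_measurable F G T)
    finally show "(\<integral>\<^sup>+x. \<integral>\<^sup>+t. fF T t x * fG T t x \<partial>M i \<partial>PiM I M)
      \<le> (\<integral>\<^sup>+x. energy M (insert i I) (insert i T) F x * energy M (insert i I) (insert i T) G x
            \<partial>PiM (insert i I) M)" by simp
  qed simp_all
  also have "\<dots> = (\<Sum>T\<in>Pow (insert i I). ennreal \<beta> ^ card T *
      (\<integral>\<^sup>+x. energy M (insert i I) T F x * energy M (insert i I) T G x \<partial>PiM (insert i I) M))"
    (is "?L = (\<Sum>T\<in>_. ?B T)")
  proof -
    have "?B (insert i T) = ennreal \<beta> ^ card T * (ennreal \<beta> * (\<integral>\<^sup>+x. energy M (insert i I) (insert i T) F x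
        * energy M (insert i I) (insert i T) G x \<partial>PiM (insert i I) M))" if "T \<in> Pow I" for T
    proof -
      have "finite T" "i \<notin> T" using that I by (auto intro: finite_subset)
      then show ?thesis by (simp add: mult_ac)
    qed
    then have "?L = (\<Sum>T\<in>Pow I. ?B T) + (\<Sum>T\<in>Pow I. ?B (insert i T))"
      by (simp add: distrib_left sum.distrib)
    also have "(\<Sum>T\<in>Pow I. ?B (insert i T)) = (\<Sum>T\<in>insert i ` Pow I. ?B T)"
      by (subst sum.reindex[OF inj_on_insert_Pow[OF I(2)]]) simp
    also have "(\<Sum>T\<in>Pow I. ?B T) + (\<Sum>T\<in>insert i ` Pow I. ?B T) = (\<Sum>T\<in>Pow (insert i I). ?B T)"
      unfolding Pow_insert using I by (intro sum.union_disjoint[symmetric]) auto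
    finally show ?thesis .
  qed
  finally show ?case .
qed

end

section \<open>The Efron--Stein decomposition\<close>

lemma avg_op_cong:
  assumes "\<And>j. j \<in> T \<Longrightarrow> x j = y j"
  shows "avg_op I M T f x = avg_op I M T f y"
proof -
  have "merge T (I - T) (x, z) = merge T (I - T) (y, z)" for z
    using assms by (simp add: merge_def fun_eq_iff)
  then show ?thesis unfolding avg_op_def by simp
qed

lemma efron_stein_cong:
  "(\<And>j. j \<in> S \<Longrightarrow> x j = y j) \<Longrightarrow> efron_stein I M S f x = efron_stein I M S f y"
  unfolding efron_stein_def by (intro sum.cong refl arg_cong2[where f="(*)"] avg_op_cong) auto

text \<open>Pairs \<open>T\<close> with \<open>insert i T\<close>, whose signs are opposite. The
  differences telescope in the inversion below and, for averages, have mean zero in coordinate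
  \<open>i\<close>.\<close>

lemma alternating_sum_insert:
  fixes a :: "'i set \<Rightarrow> real"
  assumes "finite S" "i \<notin> S"
  shows "(\<Sum>T\<in>Pow (insert i S). (-1) ^ card (insert i S - T) * a T)
    = (\<Sum>T\<in>Pow S. (-1) ^ card (S - T) * (a (insert i T) - a T))"
proof -
  have "(\<Sum>T\<in>Pow (insert i S). (-1) ^ card (insert i S - T) * a T)
      = (\<Sum>T\<in>Pow S. (-1) ^ card (insert i S - T) * a T)
        + (\<Sum>T\<in>insert i ` Pow S. (-1) ^ card (insert i S - T) * a T)"
    unfolding Pow_insert using assms by (intro sum.union_disjoint) auto
  also have "(\<Sum>T\<in>insert i ` Pow S. (-1) ^ card (insert i S - T) * a T)
      = (\<Sum>T\<in>Pow S. (-1) ^ card (S - T) * a (insert i T))"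
    using assms by (subst sum.reindex[OF inj_on_insert_Pow[OF assms(2)]]) (auto intro!: sum.cong)
  also have "(\<Sum>T\<in>Pow S. (-1) ^ card (insert i S - T) * a T) = (\<Sum>T\<in>Pow S. - ((-1) ^ card (S - T) * a T))"
  proof (intro sum.cong refl)
    fix T assume "T \<in> Pow S"
    then have "insert i S - T = insert i (S - T)" using assms by auto
    then show "(-1) ^ card (insert i S - T) * a T = - ((-1) ^ card (S - T) * a T)"
      using assms by simp
  qed
  finally show ?thesis
    by (simp add: sum.distrib[symmetric] right_diff_distrib sum_subtractf sum_negf)
qed

text \<open>Moebius inversion on the subset lattice. In the inductive step the sets without
  \<open>i\<close> sum to \<open>a I\<close>; those with \<open>i\<close> sum to
  \<open>a (insert i I) - a I\<close>, by the hypothesis for the differences, which is why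
  \<open>a\<close> is generalized.\<close>

lemma alternating_sum_inversion:
  fixes a :: "'i set \<Rightarrow> real"
  assumes "finite I"
  shows "(\<Sum>S\<in>Pow I. \<Sum>T\<in>Pow S. (-1) ^ card (S - T) * a T) = a I"
  using assms
proof (induction I arbitrary: a rule: finite_induct)
  case (insert i I)
  let ?b = "\<lambda>S. \<Sum>T\<in>Pow S. (-1) ^ card (S - T) * a T"
  have "(\<Sum>S\<in>Pow (insert i I). ?b S) = (\<Sum>S\<in>Pow I. ?b S) + (\<Sum>S\<in>insert i ` Pow I. ?b S)"
    unfolding Pow_insert using insert.hyps by (intro sum.union_disjoint) auto
  also have "(\<Sum>S\<in>insert i ` Pow I. ?b S) = (\<Sum>S\<in>Pow I. ?b (insert i S))"
    by (subst sum.reindex[OF inj_on_insert_Pow[OF insert.hyps(2)]]) simp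
  also have "\<dots> = (\<Sum>S\<in>Pow I. \<Sum>T\<in>Pow S. (-1) ^ card (S - T) * (a (insert i T) - a T))"
    using insert.hyps by (intro sum.cong refl alternating_sum_insert) (auto intro: finite_subset)
  also have "\<dots> = a (insert i I) - a I" by (rule insert.IH)
  finally show ?case using insert.IH[of a] by simp
qed simp

section \<open>Square-integrable functions\<close>

lemma integrable_product_L2:
  assumes "in_L2 N u" "in_L2 N v"
  shows "integrable N (\<lambda>x. u x * v x)"
proof (rule Bochner_Integration.integrable_bound)
  show "integrable N (\<lambda>x. (u x)\<^sup>2 + (v x)\<^sup>2)" using assms by (simp add: in_L2_def)
  show "AE x in N. norm (u x * v x) \<le> norm ((u x)\<^sup>2 + (v x)\<^sup>2)"
  proof (rule AE_I2)
    fix x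
    have "2 * (\<bar>u x\<bar> * \<bar>v x\<bar>) \<le> (u x)\<^sup>2 + (v x)\<^sup>2" using sum_squares_bound[of "\<bar>u x\<bar>" "\<bar>v x\<bar>"] by simp
    moreover have "0 \<le> \<bar>u x\<bar> * \<bar>v x\<bar>" by simp
    ultimately show "norm (u x * v x) \<le> norm ((u x)\<^sup>2 + (v x)\<^sup>2)"
      unfolding real_norm_def abs_mult by linarith
  qed
qed (use assms in \<open>auto simp: in_L2_def\<close>)

lemma in_L2_add: "in_L2 N u \<Longrightarrow> in_L2 N v \<Longrightarrow> in_L2 N (\<lambda>x. u x + v x)"
  using integrable_product_L2[of N u v]
  unfolding in_L2_def power2_sum mult.assoc by (elim conjE, intro conjI) simp_all

lemma in_L2_cmult: "in_L2 N u \<Longrightarrow> in_L2 N (\<lambda>x. c * u x)"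
  unfolding in_L2_def power_mult_distrib by (elim conjE, intro conjI) auto

lemma in_L2_sum: "finite A \<Longrightarrow> (\<And>s. s \<in> A \<Longrightarrow> in_L2 N (u s)) \<Longrightarrow> in_L2 N (\<lambda>x. \<Sum>s\<in>A. u s x)"
proof (induction A rule: finite_induct)
  case empty
  show ?case by (simp add: in_L2_def)
next
  case (insert s A)
  then show ?case using in_L2_add[of N "u s" "\<lambda>x. \<Sum>s\<in>A. u s x"] by simp
qed

text \<open>Pythagoras. The detour through the Bochner integral lets the signed cross terms
  vanish.\<close>

lemma nn_integral_square_sum_orthogonal:
  assumes "finite A" and L2: "\<And>s. s \<in> A \<Longrightarrow> in_L2 N (u s)"
    and orth: "\<And>s s'. s \<in> A \<Longrightarrow> s' \<in> A \<Longrightarrow> s \<noteq> s' \<Longrightarrow> (\<integral>x. u s x * u s' x \<partial>N) = 0"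
  shows "(\<integral>\<^sup>+x. ennreal ((\<Sum>s\<in>A. u s x)\<^sup>2) \<partial>N) = (\<Sum>s\<in>A. \<integral>\<^sup>+x. ennreal ((u s x)\<^sup>2) \<partial>N)"
proof -
  note int = integrable_product_L2[OF L2 L2]
  have "(\<integral>\<^sup>+x. ennreal ((\<Sum>s\<in>A. u s x)\<^sup>2) \<partial>N) = ennreal (\<integral>x. (\<Sum>s\<in>A. u s x)\<^sup>2 \<partial>N)"
    using in_L2_sum[OF assms(1) L2] by (intro nn_integral_eq_integral) (auto simp: in_L2_def)
  also have "(\<integral>x. (\<Sum>s\<in>A. u s x)\<^sup>2 \<partial>N) = (\<Sum>s\<in>A. \<Sum>s'\<in>A. \<integral>x. u s x * u s' x \<partial>N)"
    unfolding power2_eq_square sum_product using int by simp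
  also have "\<dots> = (\<Sum>s\<in>A. \<integral>x. (u s x)\<^sup>2 \<partial>N)"
  proof (intro sum.cong refl)
    fix s assume s: "s \<in> A"
    have "(\<Sum>s'\<in>A. \<integral>x. u s x * u s' x \<partial>N) = (\<Sum>s'\<in>A. if s' = s then \<integral>x. (u s x)\<^sup>2 \<partial>N else 0)"
      using s orth by (intro sum.cong refl) (auto simp: power2_eq_square)
    then show "(\<Sum>s'\<in>A. \<integral>x. u s x * u s' x \<partial>N) = (\<integral>x. (u s x)\<^sup>2 \<partial>N)"
      using s assms(1) by simp
  qed
  also have "ennreal \<dots> = (\<Sum>s\<in>A. ennreal (\<integral>x. (u s x)\<^sup>2 \<partial>N))" by (simp add: sum_ennreal)
  also have "\<dots> = (\<Sum>s\<in>A. \<integral>\<^sup>+x. ennreal ((u s x)\<^sup>2) \<partial>N)"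
    using L2 by (intro sum.cong refl nn_integral_eq_integral[symmetric]) (auto simp: in_L2_def)
  finally show ?thesis .
qed

text \<open>Nonnegativity of the variance when the second moment is finite; trivial
  otherwise.\<close>

lemma (in prob_space) square_integral_le_nn_integral:
  fixes g :: "'a \<Rightarrow> real"
  assumes [measurable]: "g \<in> borel_measurable M"
  shows "ennreal ((integral\<^sup>L M g)\<^sup>2) \<le> (\<integral>\<^sup>+x. ennreal ((g x)\<^sup>2) \<partial>M)"
proof (cases "(\<integral>\<^sup>+x. ennreal ((g x)\<^sup>2) \<partial>M) = \<infinity>")
  case False
  then have 2: "integrable M (\<lambda>x. (g x)\<^sup>2)"
    by (intro integrableI_nonneg) (auto simp: less_top)
  have 1: "integrable M g" by (rule square_integrable_imp_integrable[OF assms 2])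
  have "(integral\<^sup>L M g)\<^sup>2 \<le> (\<integral>x. (g x)\<^sup>2 \<partial>M)"
    using variance_eq[OF 1 2] variance_positive[of g] by simp
  then show ?thesis using 2 by (simp add: nn_integral_eq_integral ennreal_leI)
qed simp

context prob_family
begin

section \<open>Averages, components and influences\<close>

lemma measurable_merge_section_restrict:
  assumes "G \<in> borel_measurable (PiM I M)" "T \<subseteq> I" "x \<in> space (PiM I M)"
  shows "(\<lambda>y. G (merge T (I - T) (x, y))) \<in> borel_measurable (PiM (I - T) M)"
proof -
  have x: "restrict x T \<in> space (PiM T M)" using assms by (auto simp: space_PiM)
  have "T \<union> (I - T) = I" using assms by auto
  then have "G \<in> borel_measurable (PiM (T \<union> (I - T)) M)" using assms by simp
  from measurable_compose[OF measurable_Pair1'[OF x] measurable_compose[OF measurable_merge this]]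
  show ?thesis by simp
qed

lemma avg_op_eq:
  assumes "finite I" "T \<subseteq> I" "f \<in> borel_measurable (PiM I M)" "x \<in> space (PiM I M)"
  shows "avg_op I M T f x = (\<integral>y. f (merge T (I - T) (x, y)) \<partial>PiM I M)"
  unfolding avg_op_def
  by (rule integral_Pi_restrict) (use assms measurable_merge_section_restrict in auto)

text \<open>Averaging contracts the norm: the variance bound on each section, followed by invariance
  of the product measure under splicing.\<close>

lemma avg_op_L2:
  assumes I: "finite I" and T: "T \<subseteq> I" and f: "in_L2 (PiM I M) f"
  shows "in_L2 (PiM I M) (avg_op I M T f)"
proof -
  interpret prob_space "PiM I M" by (rule prob_space_Pi)
  have [measurable]: "f \<in> borel_measurable (PiM I M)" using f by (simp add: in_L2_def)
  have [measurable]: "(\<lambda>(x, y). f (merge T (I - T) (x, y))) \<in> borel_measurable (PiM I M \<Otimes>\<^sub>M PiM I M)"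
    using measurable_compose[OF measurable_merge_self[OF T], of f borel] by simp
  have "(\<lambda>x. \<integral>y. f (merge T (I - T) (x, y)) \<partial>PiM I M) \<in> borel_measurable (PiM I M)"
    by measurable
  then have meas[measurable]: "avg_op I M T f \<in> borel_measurable (PiM I M)"
    by (subst measurable_cong[OF avg_op_eq[OF I T]]) auto
  have "(\<integral>\<^sup>+x. ennreal ((avg_op I M T f x)\<^sup>2) \<partial>PiM I M)
      \<le> (\<integral>\<^sup>+x. \<integral>\<^sup>+y. ennreal ((f (merge T (I - T) (x, y)))\<^sup>2) \<partial>PiM I M \<partial>PiM I M)"
    by (intro nn_integral_mono)
      (simp add: avg_op_eq[OF I T] square_integral_le_nn_integral measurable_merge_section[OF _ T])
  also have "\<dots> = (\<integral>\<^sup>+x. ennreal ((f x)\<^sup>2) \<partial>PiM I M)"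
    by (rule nn_integral_merge[OF I T]) measurable
  also have "\<dots> < \<infinity>" using f by (simp add: in_L2_def integrable_iff_bounded)
  finally show ?thesis
    unfolding in_L2_def by (intro conjI meas integrableI_nonneg) auto
qed

text \<open>The tower property: averaging coordinate \<open>i\<close> out of the average for
  \<open>insert i T\<close> gives that for \<open>T\<close>. Splicing \<open>x(i := t)\<close> with
  \<open>y\<close> along \<open>insert i T\<close> is splicing \<open>x\<close> with
  \<open>y(i := t)\<close> along \<open>T\<close>, so this is Fubini in \<open>y\<close>, valid at
  those \<open>x\<close> whose section is integrable.\<close>

lemma avg_op_insert:
  assumes I: "finite I" and T: "T \<subseteq> I" and i: "i \<in> I" "i \<notin> T" and f: "in_L2 (PiM I M) f"
  shows "AE x in PiM I M. integrable (M i) (\<lambda>t. avg_op I M (insert i T) f (x(i := t)))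
    \<and> (\<integral>t. avg_op I M (insert i T) f (x(i := t)) \<partial>M i) = avg_op I M T f x"
proof -
  interpret P: pair_sigma_finite "PiM I M" "PiM I M" by (rule pair_sigma_finite_Pi)
  have fm: "f \<in> borel_measurable (PiM I M)" using f by (simp add: in_L2_def)
  have int: "integrable (PiM I M) f"
    by (rule finite_measure.square_integrable_imp_integrable[OF prob_space.finite_measure[OF prob_space_Pi]])
      (use f in \<open>simp_all add: in_L2_def\<close>)
  have ins: "insert i I = I" "insert i T \<subseteq> I" using i T by auto
  have "integrable (PiM I M \<Otimes>\<^sub>M PiM I M) (\<lambda>w. f (merge T (I - T) w))"
    by (rule integrable_distr[OF measurable_merge_self[OF T]]) (use int distr_merge_self[OF I T] in simp)
  from P.AE_integrable_fst'[OF this] AE_space show ?thesis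
  proof eventually_elim
    case (elim x)
    let ?g = "\<lambda>y. f (merge T (I - T) (x, y))"
    have g: "integrable (PiM (insert i I) M) ?g" using elim(1) ins by simp
    have eq: "avg_op I M (insert i T) f (x(i := t)) = (\<integral>y. ?g (y(i := t)) \<partial>PiM I M)" if "t \<in> space (M i)" for t
    proof -
      have "x(i := t) \<in> space (PiM I M)"
        using elim(2) that i by (auto simp: space_PiM PiE_iff extensional_def)
      moreover have "merge (insert i T) (I - insert i T) (x(i := t), y) = merge T (I - T) (x, y(i := t))" for y
        using i by (auto simp: merge_def fun_eq_iff)
      ultimately show ?thesis by (simp add: avg_op_eq[OF I ins(2) fm])
    qed
    have "integrable (M i) (\<lambda>t. avg_op I M (insert i T) f (x(i := t)))"
      using integral_insert_coordinate(3)[OF g] by (subst Bochner_Integration.integrable_cong[OF refl eq]) auto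
    moreover have "(\<integral>t. avg_op I M (insert i T) f (x(i := t)) \<partial>M i) = avg_op I M T f x"
      using integral_insert_coordinate(4)[OF g] ins elim(2)
      by (subst Bochner_Integration.integral_cong[OF refl eq]) (auto simp: avg_op_eq[OF I T fm])
    ultimately show ?case ..
  qed
qed

text \<open>The mean-zero property is the tower property applied to each pair \<open>T\<close>,
  \<open>insert i T\<close> in the alternating sum. The free weights \<open>c\<close> admit the
  rescaled family needed at the end.\<close>

lemma es_family_efron_stein:
  assumes I: "finite I" and f: "in_L2 (PiM I M) f"
  shows "es_family M I (\<lambda>S x. c S * efron_stein I M S f x)"
  unfolding es_family_def
proof (intro allI impI conjI ballI)
  fix S assume S: "S \<subseteq> I"
  then have fin: "finite S" using I finite_subset by blast
  show "c S * efron_stein I M S f x = c S * efron_stein I M S f y" if "\<forall>j\<in>S. x j = y j" for x y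
    using that efron_stein_cong[of S x y] by auto
  show "in_L2 (PiM I M) (\<lambda>x. c S * efron_stein I M S f x)"
    unfolding efron_stein_def using S fin by (intro in_L2_cmult in_L2_sum avg_op_L2 I f) auto
  fix i assume i: "i \<in> S"
  define S' where "S' = S - {i}"
  have S': "S = insert i S'" "finite S'" "i \<notin> S'" using i fin by (auto simp: S'_def)
  have "AE x in PiM I M. \<forall>T\<in>Pow S'. integrable (M i) (\<lambda>t. avg_op I M (insert i T) f (x(i := t)))
    \<and> (\<integral>t. avg_op I M (insert i T) f (x(i := t)) \<partial>M i) = avg_op I M T f x"
    using S S' by (intro AE_finite_allI avg_op_insert I f) auto
  then show "AE x in PiM I M. (\<integral>t. c S * efron_stein I M S f (x(i := t)) \<partial>M i) = 0"
  proof eventually_elim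
    case (elim x)
    have "efron_stein I M S f (x(i := t))
        = (\<Sum>T\<in>Pow S'. (-1) ^ card (S' - T) * (avg_op I M (insert i T) f (x(i := t)) - avg_op I M T f x))" for t
    proof -
      have "avg_op I M T f (x(i := t)) = avg_op I M T f x" if "T \<in> Pow S'" for T
        using that S' by (intro avg_op_cong) auto
      then show ?thesis
        unfolding efron_stein_def S'(1) alternating_sum_insert[OF S'(2,3)] by simp
    qed
    then show ?case
      using elim by (simp add: prob_space.prob_space[OF prob_space_M])
  qed
qed

text \<open>Inversion leaves the average over no coordinates. It is the identity at points of the
  space, which are \<open>undefined\<close> outside \<open>I\<close> just as the merged point
  is.\<close>

lemma sum_efron_stein:
  assumes "finite I" "x \<in> space (PiM I M)"
  shows "(\<Sum>S\<in>Pow I. efron_stein I M S f x) = f x"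
proof -
  have "(\<Sum>S\<in>Pow I. efron_stein I M S f x) = avg_op I M I f x"
    unfolding efron_stein_def by (rule alternating_sum_inversion[OF assms(1)])
  also have "\<dots> = f x"
  proof -
    have "merge I {} (x, y) = x" for y
      using assms(2) by (auto simp: merge_def fun_eq_iff space_PiM PiE_iff extensional_def)
    then show ?thesis by (simp add: avg_op_def prob_space.prob_space[OF prob_space_Pi])
  qed
  finally show ?thesis .
qed

text \<open>Orthogonality on almost every section: two distinct sets containing \<open>T\<close>
  differ in some \<open>i\<close> outside \<open>T\<close>. That coordinate is still integrated once
  \<open>x\<close> is fixed, and the component containing it has mean zero there.\<close>

lemma energy_eq_square_sum:
  assumes I: "finite I" and T: "T \<subseteq> I" and F: "es_family M I F"
  shows "AE x in PiM I M. energy M I T F x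
    = (\<integral>\<^sup>+y. ennreal ((\<Sum>S | T \<subseteq> S \<and> S \<subseteq> I. F S (merge T (I - T) (x, y)))\<^sup>2) \<partial>PiM I M)"
proof -
  interpret P: pair_sigma_finite "PiM I M" "PiM I M" by (rule pair_sigma_finite_Pi)
  have "AE x in PiM I M. integrable (PiM I M) (\<lambda>y. (F S (merge T (I - T) (x, y)))\<^sup>2)" if "S \<subseteq> I" for S
    by (rule P.AE_integrable_fst', rule integrable_distr[OF measurable_merge_self[OF T]])
      (use es_family_square_integrable[OF F that] distr_merge_self[OF I T] in simp)
  then have 1: "AE x in PiM I M. \<forall>S\<in>Pow I. integrable (PiM I M) (\<lambda>y. (F S (merge T (I - T) (x, y)))\<^sup>2)"
    using I by (intro AE_finite_allI) auto
  have 2: "AE x in PiM I M. \<forall>S\<in>Pow I. \<forall>i\<in>S. AE y in PiM I M.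
      (\<integral>t. F S ((merge T (I - T) (x, y))(i := t)) \<partial>M i) = 0"
    using I by (intro AE_finite_allI AE_merge[OF I T] es_family_mean_zero[OF F]) (auto intro: finite_subset)
  from 1 2 AE_space show ?thesis
  proof eventually_elim
    case (elim x)
    define u where "u S y = F S (merge T (I - T) (x, y))" for S y
    have L2: "in_L2 (PiM I M) (u S)" if "S \<subseteq> I" for S
      using elim(1) that measurable_merge_section[OF es_family_measurable[OF F that] T elim(3)]
      by (auto simp: in_L2_def u_def[abs_def])
    have *: "(\<integral>y. u S y * u S' y \<partial>PiM I M) = 0"
      if S: "S \<subseteq> I" "S' \<subseteq> I" "i \<in> S" "i \<notin> S'" "i \<notin> T" for S S' i
    proof -
      have merge: "merge T (I - T) (x, y(i := t)) = (merge T (I - T) (x, y))(i := t)" for y t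
        using S by (auto simp: merge_def fun_eq_iff)
      have "insert i I = I" using S by auto
      then have "(\<integral>y. u S y * u S' y \<partial>PiM I M) = (\<integral>y. \<integral>t. u S (y(i := t)) * u S' (y(i := t)) \<partial>M i \<partial>PiM I M)"
        using integral_insert_coordinate(5)[of i I "\<lambda>y. u S y * u S' y"]
          integrable_product_L2[OF L2[OF S(1)] L2[OF S(2)]] by simp
      \<comment> \<open>The second factor does not see coordinate \<open>i\<close> and leaves the
        inner integral.\<close>
      also have "\<dots> = (\<integral>y. (\<integral>t. u S (y(i := t)) \<partial>M i) * u S' y \<partial>PiM I M)"
        unfolding u_def merge es_family_upd[OF F S(2) S(4)] by simp
      also have "\<dots> = 0"
      proof (rule integral_eq_zero_AE)
        have "AE y in PiM I M. (\<integral>t. u S (y(i := t)) \<partial>M i) = 0"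
          using elim(2) S unfolding u_def merge by blast
        then show "AE y in PiM I M. (\<integral>t. u S (y(i := t)) \<partial>M i) * u S' y = 0"
          by eventually_elim simp
      qed
      finally show ?thesis .
    qed
    have orth: "(\<integral>y. u S y * u S' y \<partial>PiM I M) = 0"
      if S: "T \<subseteq> S \<and> S \<subseteq> I" "T \<subseteq> S' \<and> S' \<subseteq> I" "S \<noteq> S'" for S S'
    proof -
      from S obtain i where "i \<in> S \<and> i \<notin> S' \<or> i \<in> S' \<and> i \<notin> S" by blast
      then show ?thesis
        using *[of S S' i] *[of S' S i] S by (auto simp: mult.commute)
    qed
    have "(\<integral>\<^sup>+y. ennreal ((\<Sum>S | T \<subseteq> S \<and> S \<subseteq> I. u S y)\<^sup>2) \<partial>PiM I M)
        = (\<Sum>S | T \<subseteq> S \<and> S \<subseteq> I. \<integral>\<^sup>+y. ennreal ((u S y)\<^sup>2) \<partial>PiM I M)"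
      using I L2 orth by (intro nn_integral_square_sum_orthogonal) auto
    then show ?case unfolding energy_def u_def by simp
  qed
qed

lemma influence_eq_energy:
  assumes I: "finite I" and T: "T \<subseteq> I" and f: "in_L2 (PiM I M) f"
  shows "AE x in PiM I M. influence I M T x f = energy M I T (\<lambda>S. efron_stein I M S f) x"
proof -
  let ?E = "\<lambda>S. efron_stein I M S f"
  have F: "es_family M I ?E" using es_family_efron_stein[OF I f, of "\<lambda>_. 1"] by simp
  have lap: "laplacian I M T f \<in> borel_measurable (PiM I M)"
    unfolding laplacian_def[abs_def] by (intro borel_measurable_sum es_family_measurable[OF F]) auto
  from energy_eq_square_sum[OF I T F] AE_space show ?thesis
  proof eventually_elim
    case (elim x)
    have "influence I M T x f = (\<integral>\<^sup>+y. ennreal ((laplacian I M T f (merge T (I - T) (x, y)))\<^sup>2) \<partial>PiM I M)"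
      unfolding influence_def derivative_def
      by (rule nn_integral_Pi_restrict[OF I])
        (use measurable_merge_section_restrict[OF lap T elim(2)] in auto)
    then show ?case using elim(1) by (simp add: laplacian_def)
  qed
qed

lemma influence_measurable:
  assumes I: "finite I" and T: "T \<subseteq> I" and f: "in_L2 (PiM I M) f"
  shows "(\<lambda>x. influence I M T x f) \<in> borel_measurable (PiM T M)"
proof -
  interpret prob_space "PiM (I - T) M" by (rule prob_space_Pi)
  have F: "es_family M I (\<lambda>S. efron_stein I M S f)" using es_family_efron_stein[OF I f, of "\<lambda>_. 1"] by simp
  have lap: "laplacian I M T f \<in> borel_measurable (PiM I M)"
    unfolding laplacian_def[abs_def] by (intro borel_measurable_sum es_family_measurable[OF F]) auto
  have "T \<union> (I - T) = I" using T by auto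
  with measurable_compose[OF measurable_merge, of "laplacian I M T f" T "I - T" M borel] lap
  have [measurable]: "(\<lambda>(x, y). laplacian I M T f (merge T (I - T) (x, y))) \<in> borel_measurable (PiM T M \<Otimes>\<^sub>M PiM (I - T) M)"
    by simp
  show ?thesis unfolding influence_def derivative_def by measurable
qed

end

section \<open>From noise to influences\<close>

text \<open>With \<rho>^2 = (1 - \<delta>)/3 and \<delta> = 1/(4d + 1), the cost \<rho>^(-4d) is 9^d
  (1 + 1/(4d))^(2d), at most 9^d exp(1/2). The last two conclusions let \<beta> be replaced by 9d in
  the powers that occur.\<close>

lemma noise_parameters:
  fixes d :: nat
  obtains \<rho> \<delta> \<beta> :: real where "0 < \<rho>" "\<rho> \<le> 1" "0 < \<delta>" "3 * \<rho>\<^sup>2 + \<delta> \<le> 1"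
    "\<rho> ^ 4 + 2 * \<rho> ^ 6 / \<delta> \<le> \<beta>" "((1 / \<rho>) ^ d) ^ 4 \<le> 2 * 9 ^ d"
    "0 \<le> \<beta>" "\<And>j. j \<le> d \<Longrightarrow> \<beta> ^ j \<le> (9 * real d) ^ j"
proof (cases "d = 0")
  case True
  show ?thesis
    \<comment> \<open>For \<open>d = 0\<close> the only power compared is the zeroth, so \<beta> = 1
      is allowed although 9d = 0.\<close>
    by (rule that[of "1/2" "1/4" 1]) (use True in \<open>auto simp: power2_eq_square eval_nat_numeral\<close>)
next
  case False
  define n where "n = real d"
  have n: "1 \<le> n" using False by (simp add: n_def)
  define e where "e = 1 / (4 * n + 1)"
  define r where "r = (1 - e) / 3"
  have r: "0 < r" "r \<le> 1 / 3"
    using n by (simp_all add: r_def e_def field_simps)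
  have r1: "3 * r + e = 1" by (simp add: r_def field_simps)
  have s2: "(sqrt r)\<^sup>2 = r" and s4: "sqrt r ^ 4 = r\<^sup>2" and s6: "sqrt r ^ 6 = r ^ 3"
    using r power_mult[of "sqrt r" 2 2] power_mult[of "sqrt r" 2 3] by simp_all
  show ?thesis
  proof (rule that[of "sqrt r" e "9 * n"])
    have "r\<^sup>2 \<le> (1/3)\<^sup>2" "r ^ 3 \<le> (1/3) ^ 3" using r by (intro power_mono; simp)+
    \<comment> \<open>The factor \<open>4 * n + 1\<close> is the division by
      \<open>e\<close>.\<close>
    then have "r\<^sup>2 + 2 * r ^ 3 * (4 * n + 1) \<le> (1/3)\<^sup>2 + 2 * (1/3)^3 * (4 * n + 1)"
      using n by (intro add_mono mult_right_mono mult_left_mono) auto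
    also have "\<dots> \<le> 9 * n" using n by (simp add: power2_eq_square eval_nat_numeral field_simps)
    finally show "sqrt r ^ 4 + 2 * sqrt r ^ 6 / e \<le> 9 * n"
      by (simp add: s4 s6 e_def)
    have "((1 / sqrt r) ^ d) ^ 4 = (1 / r\<^sup>2) ^ d"
      by (simp add: power_mult[symmetric] mult.commute power_divide s4[symmetric])
    also have "1 / r\<^sup>2 = 9 * (1 + 1 / (4 * n))\<^sup>2"
      using n by (simp add: r_def e_def field_simps power2_eq_square)
    also have "(9 * (1 + 1 / (4 * n))\<^sup>2) ^ d = 9 ^ d * (1 + 1 / (4 * n)) ^ (2 * d)"
      by (simp add: power_mult_distrib power_mult)
    also have "\<dots> \<le> 9 ^ d * 2"
    proof (intro mult_left_mono)
      have "(1 + 1 / (4 * n)) ^ (2 * d) \<le> exp (1 / (4 * n)) ^ (2 * d)"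
        using n by (intro power_mono exp_ge_add_one_self) auto
      also have "\<dots> = exp (1 / 2)"
        using n by (simp add: exp_of_nat_mult[symmetric] n_def)
      also have "\<dots> \<le> 2"
      proof (rule power2_le_imp_le)
        have "(exp (1 / 2 :: real))\<^sup>2 = exp 1" by (simp add: power2_eq_square exp_add[symmetric])
        also have "\<dots> \<le> 2\<^sup>2" using exp_le by simp
        finally show "(exp (1 / 2 :: real))\<^sup>2 \<le> 2\<^sup>2" .
      qed simp
      finally show "(1 + 1 / (4 * n)) ^ (2 * d) \<le> 2" .
    qed simp
    finally show "((1 / sqrt r) ^ d) ^ 4 \<le> 2 * 9 ^ d" by simp
  qed (use r r1 n in \<open>simp_all add: s2 n_def e_def\<close>)
qed

lemma (in prob_family) fourth_moment_le_influences:
  fixes f :: "('i \<Rightarrow> 'a) \<Rightarrow> real"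
  assumes I: "finite I" and f: "in_L2 (PiM I M) f" and deg: "of_degree I M d f"
  shows "(\<integral>\<^sup>+x. ennreal (\<bar>f x\<bar> ^ 4) \<partial>PiM I M)
    \<le> 2 * 9 ^ d * (\<Sum>T | T \<subseteq> I \<and> card T \<le> d.
         (9 * of_nat d) ^ card T * (\<integral>\<^sup>+x. (influence I M T x f)\<^sup>2 \<partial>PiM T M))"
proof -
  obtain \<rho> \<delta> \<beta> :: real where \<rho>: "0 < \<rho>" "\<rho> \<le> 1"
    and par: "0 < \<delta>" "3 * \<rho>\<^sup>2 + \<delta> \<le> 1" "\<rho> ^ 4 + 2 * \<rho> ^ 6 / \<delta> \<le> \<beta>"
    and \<rho>d: "((1 / \<rho>) ^ d) ^ 4 \<le> 2 * 9 ^ d"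
    and \<beta>: "0 \<le> \<beta>" "\<And>j. j \<le> d \<Longrightarrow> \<beta> ^ j \<le> (9 * real d) ^ j"
    by (rule noise_parameters[of d]) blast
  let ?E = "\<lambda>S. efron_stein I M S f"
  \<comment> \<open>The weight undoes the damping. Above degree \<open>d\<close>, where components
    vanish only almost everywhere, it is zero, so that it never exceeds \<open>C\<close> and the
    energies for \<open>card T > d\<close> vanish at every point.\<close>
  define c where "c S = (if card S \<le> d then (1 / \<rho>) ^ card S else 0)" for S :: "'i set"
  define F where "F S x = c S * ?E S x" for S x
  define C where "C = (1 / \<rho>) ^ d"
  have F: "es_family M I F" unfolding F_def by (rule es_family_efron_stein[OF I f])
  have E: "es_family M I ?E" using es_family_efron_stein[OF I f, of "\<lambda>_. 1"] by simp
  have c: "(c S)\<^sup>2 \<le> C\<^sup>2" for S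
  proof (rule power_mono)
    show "c S \<le> C"
      using \<rho> unfolding c_def C_def by (auto intro!: power_increasing)
    show "0 \<le> c S" using \<rho> by (simp add: c_def)
  qed
  have "AE x in PiM I M. \<forall>S\<in>Pow I. card S > d \<longrightarrow> ?E S x = 0"
    using I deg by (intro AE_finite_allI) (auto simp: of_degree_def)
  with AE_space have fF: "AE x in PiM I M. noise_sum \<rho> I F x = f x"
  proof eventually_elim
    case (elim x)
    have "noise_sum \<rho> I F x = (\<Sum>S\<in>Pow I. ?E S x)"
      unfolding noise_sum_def
    proof (intro sum.cong refl)
      fix S assume "S \<in> Pow I"
      then show "\<rho> ^ card S * F S x = ?E S x"
        using elim(2) \<rho> by (auto simp: F_def c_def power_divide)
    qed
    then show ?case using sum_efron_stein[OF I elim(1)] by simp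
  qed
  have energy_le: "energy M I T F x \<le> ennreal (C\<^sup>2) * energy M I T ?E x"
    if T: "T \<subseteq> I" and x: "x \<in> space (PiM I M)" for T x
    unfolding energy_def sum_distrib_left
  proof (rule sum_mono)
    fix S assume S: "S \<in> {S. T \<subseteq> S \<and> S \<subseteq> I}"
    have m: "(\<lambda>y. ?E S (merge T (I - T) (x, y))) \<in> borel_measurable (PiM I M)"
      using S by (intro measurable_merge_section[OF es_family_measurable[OF E] T x]) auto
    have "(\<integral>\<^sup>+y. ennreal ((F S (merge T (I - T) (x, y)))\<^sup>2) \<partial>PiM I M)
        \<le> (\<integral>\<^sup>+y. ennreal (C\<^sup>2) * ennreal ((?E S (merge T (I - T) (x, y)))\<^sup>2) \<partial>PiM I M)"
      using c by (intro nn_integral_mono)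
        (auto simp: F_def power_mult_distrib ennreal_mult[symmetric] intro!: ennreal_leI mult_right_mono)
    also have "\<dots> = ennreal (C\<^sup>2) * (\<integral>\<^sup>+y. ennreal ((?E S (merge T (I - T) (x, y)))\<^sup>2) \<partial>PiM I M)"
      using m by (intro nn_integral_cmult) measurable
    finally show "(\<integral>\<^sup>+y. ennreal ((F S (merge T (I - T) (x, y)))\<^sup>2) \<partial>PiM I M)
        \<le> ennreal (C\<^sup>2) * (\<integral>\<^sup>+y. ennreal ((?E S (merge T (I - T) (x, y)))\<^sup>2) \<partial>PiM I M)" .
  qed
  have energy_zero: "energy M I T F x = 0" if "\<not> card T \<le> d" for T x
    unfolding energy_def
  proof (intro sum.neutral ballI)
    fix S assume "S \<in> {S. T \<subseteq> S \<and> S \<subseteq> I}"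
    then have "card T \<le> card S" using I by (auto intro!: card_mono intro: finite_subset)
    then have "c S = 0" using that by (simp add: c_def)
    then show "(\<integral>\<^sup>+y. ennreal ((F S (merge T (I - T) (x, y)))\<^sup>2) \<partial>PiM I M) = 0"
      by (simp add: F_def)
  qed
  \<comment> \<open>Each of the two energies costs \<open>C\<^sup>2\<close>, together
    \<rho>^(-4d).\<close>
  have C4: "ennreal (C\<^sup>2) * ennreal (C\<^sup>2) \<le> 2 * 9 ^ d"
  proof -
    have "ennreal (C\<^sup>2) * ennreal (C\<^sup>2) = ennreal (C ^ 4)"
      by (simp add: ennreal_mult[symmetric] power_add[symmetric])
    also have "\<dots> \<le> ennreal (2 * 9 ^ d)" using \<rho>d by (intro ennreal_leI) (simp add: C_def)
    also have "\<dots> = 2 * 9 ^ d" by (simp add: ennreal_mult ennreal_power[symmetric])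
    finally show ?thesis .
  qed
  have \<beta>': "ennreal \<beta> ^ j \<le> (9 * of_nat d) ^ j" if "j \<le> d" for j
  proof -
    have "ennreal \<beta> ^ j = ennreal (\<beta> ^ j)" using \<beta> by (simp add: ennreal_power)
    also have "\<dots> \<le> ennreal ((9 * real d) ^ j)" using \<beta>(2)[OF that] by (rule ennreal_leI)
    also have "\<dots> = (9 * of_nat d) ^ j"
      by (simp add: ennreal_power[symmetric] ennreal_mult ennreal_of_nat_eq_real_of_nat)
    finally show ?thesis .
  qed
  have "(\<integral>\<^sup>+x. ennreal (\<bar>f x\<bar> ^ 4) \<partial>PiM I M)
      = (\<integral>\<^sup>+x. ennreal ((noise_sum \<rho> I F x)\<^sup>2 * (noise_sum \<rho> I F x)\<^sup>2) \<partial>PiM I M)"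
    using fF by (intro nn_integral_cong_AE) (auto elim!: eventually_mono simp: power_add[symmetric])
  also have "\<dots> \<le> (\<Sum>T\<in>Pow I. ennreal \<beta> ^ card T * (\<integral>\<^sup>+x. energy M I T F x * energy M I T F x \<partial>PiM I M))"
    by (rule noise_sum_fourth_moment_le[OF less_imp_le[OF \<rho>(1)] par I F F])
  also have "\<dots> = (\<Sum>T | T \<subseteq> I \<and> card T \<le> d.
      ennreal \<beta> ^ card T * (\<integral>\<^sup>+x. energy M I T F x * energy M I T F x \<partial>PiM I M))"
    using I by (intro sum.mono_neutral_right) (auto simp: energy_zero)
  also have "\<dots> \<le> (\<Sum>T | T \<subseteq> I \<and> card T \<le> d.
      (9 * of_nat d) ^ card T * (2 * 9 ^ d * (\<integral>\<^sup>+x. (influence I M T x f)\<^sup>2 \<partial>PiM T M)))"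
  proof (intro sum_mono mult_mono)
    fix T assume "T \<in> {T. T \<subseteq> I \<and> card T \<le> d}"
    then have T: "T \<subseteq> I" "card T \<le> d" by auto
    show "ennreal \<beta> ^ card T \<le> (9 * of_nat d) ^ card T" by (rule \<beta>'[OF T(2)])
    note m = energy_measurable[OF E T(1)]
    have "(\<integral>\<^sup>+x. energy M I T F x * energy M I T F x \<partial>PiM I M)
        \<le> (\<integral>\<^sup>+x. (ennreal (C\<^sup>2) * energy M I T ?E x) * (ennreal (C\<^sup>2) * energy M I T ?E x) \<partial>PiM I M)"
      by (intro nn_integral_mono mult_mono energy_le T(1)) auto
    also have "\<dots> = (\<integral>\<^sup>+x. (ennreal (C\<^sup>2) * ennreal (C\<^sup>2)) * (energy M I T ?E x)\<^sup>2 \<partial>PiM I M)"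
      by (simp add: power2_eq_square mult_ac)
    also have "\<dots> = (ennreal (C\<^sup>2) * ennreal (C\<^sup>2)) * (\<integral>\<^sup>+x. (energy M I T ?E x)\<^sup>2 \<partial>PiM I M)"
      using m by (intro nn_integral_cmult) measurable
    also have "\<dots> \<le> 2 * 9 ^ d * (\<integral>\<^sup>+x. (energy M I T ?E x)\<^sup>2 \<partial>PiM I M)"
      by (intro mult_right_mono C4) auto
    also have "(\<integral>\<^sup>+x. (energy M I T ?E x)\<^sup>2 \<partial>PiM I M) = (\<integral>\<^sup>+x. (influence I M T x f)\<^sup>2 \<partial>PiM I M)"
      using influence_eq_energy[OF I T(1) f] by (intro nn_integral_cong_AE) (auto elim!: eventually_mono)
    \<comment> \<open>The influence reads \<open>x\<close> only on \<open>T\<close>, so the other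
      coordinates integrate out.\<close>
    also have "\<dots> = (\<integral>\<^sup>+x. (influence I M T x f)\<^sup>2 \<partial>PiM T M)"
    proof (rule nn_integral_Pi_restrict[OF I T(1), symmetric])
      show "(\<lambda>x. (influence I M T x f)\<^sup>2) \<in> borel_measurable (PiM T M)"
        using influence_measurable[OF I T(1) f] by measurable
    qed (simp add: influence_def derivative_def)
    finally show "(\<integral>\<^sup>+x. energy M I T F x * energy M I T F x \<partial>PiM I M)
        \<le> 2 * 9 ^ d * (\<integral>\<^sup>+x. (influence I M T x f)\<^sup>2 \<partial>PiM T M)" .
  qed auto
  also have "\<dots> = 2 * 9 ^ d * (\<Sum>T | T \<subseteq> I \<and> card T \<le> d.
         (9 * of_nat d) ^ card T * (\<integral>\<^sup>+x. (influence I M T x f)\<^sup>2 \<partial>PiM T M))"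
    by (simp add: sum_distrib_left mult_ac)
  finally show ?thesis .
qed

theorem theorem2p7:
  fixes k d :: nat
    and M :: "nat \<Rightarrow> 'a measure"
    and f :: "(nat \<Rightarrow> 'a) \<Rightarrow> real"
  assumes "\<And>i. i \<in> {1..k} \<Longrightarrow> prob_space (M i)"
    and "in_L2 (PiM {1..k} M) f"
    and "of_degree {1..k} M d f"
  shows "(\<integral>\<^sup>+x. ennreal (\<bar>f x\<bar> ^ 4) \<partial>PiM {1..k} M)
    \<le> 2 * 9 ^ d * (\<Sum>T | T \<subseteq> {1..k} \<and> card T \<le> d.
         (9 * of_nat d) ^ card T * (\<integral>\<^sup>+x. (influence {1..k} M T x f)\<^sup>2 \<partial>PiM T M))"
proof -
  \<comment> \<open>The locale needs a probability measure at every index, also outside \<open>{1..k}\<close>.\<close>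
  define M' where "M' i = (if i \<in> {1..k} then M i else return (count_space UNIV) undefined)" for i
  interpret prob_family M'
  proof (rule prob_family.intro)
    show "prob_space (M' i)" for i
      by (cases "i \<in> {1..k}") (simp_all only: M'_def assms(1) prob_space_return space_count_space UNIV_I if_True if_False)
  qed
  \<comment> \<open>The definitions involve only product measures over subsets of
    \<open>{1..k}\<close>, where both families of measures agree.\<close>
  have Pi: "PiM J M' = PiM J M" if "J \<subseteq> {1..k}" for J
    using that by (intro PiM_cong) (auto simp: M'_def)
  have diff: "PiM ({1..k} - J) M' = PiM ({1..k} - J) M" for J
    by (rule Pi) auto
  have avg: "avg_op {1..k} M' T g = avg_op {1..k} M T g" for T g
    by (rule ext) (simp only: avg_op_def diff)
  have es: "efron_stein {1..k} M' S g = efron_stein {1..k} M S g" for S g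
    by (rule ext) (simp only: efron_stein_def avg)
  have inf: "influence {1..k} M' T x g = influence {1..k} M T x g" for T x g
    by (simp only: influence_def derivative_def laplacian_def es diff)
  have "of_degree {1..k} M' d f"
    using assms(3) unfolding of_degree_def es Pi[OF order_refl] .
  then have "(\<integral>\<^sup>+x. ennreal (\<bar>f x\<bar> ^ 4) \<partial>PiM {1..k} M')
    \<le> 2 * 9 ^ d * (\<Sum>T | T \<subseteq> {1..k} \<and> card T \<le> d.
         (9 * of_nat d) ^ card T * (\<integral>\<^sup>+x. (influence {1..k} M' T x f)\<^sup>2 \<partial>PiM T M'))"
    by (intro fourth_moment_le_influences finite_atLeastAtMost) (use assms(2) in \<open>simp_all add: Pi\<close>)
  also have "(\<Sum>T | T \<subseteq> {1..k} \<and> card T \<le> d.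
         (9 * of_nat d) ^ card T * (\<integral>\<^sup>+x. (influence {1..k} M' T x f)\<^sup>2 \<partial>PiM T M'))
    = (\<Sum>T | T \<subseteq> {1..k} \<and> card T \<le> d.
         (9 * of_nat d) ^ card T * (\<integral>\<^sup>+x. (influence {1..k} M T x f)\<^sup>2 \<partial>PiM T M))"
    unfolding inf by (intro sum.cong refl) (simp add: Pi)
  finally show ?thesis unfolding Pi[OF order_refl] .
qed

end
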